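(* Let $(M,J,g,\tilde g)$ be a $2n$-dimensional almost skew-Hermitian manifold, and let $TM$ be its tangent bundle with the almost complex structure $J_1$ and the Sasaki metric $\hat g$ defined in the context. Then $(TM,J_1,\hat g)$ is an almost Kähler manifold, and it is a Kähler manifold if and only if $(M,J,g,\tilde g)$ is flat.
   Context: An almost skew-Hermitian manifold $(M^{2n},J,g,\tilde g)$ is a smooth $2n$-manifold with an almost complex structure $J$ and a pseudo-Riemannian metric $g$ of signature $(n,n)$ with $g(JX,JY)=-g(X,Y)$; $\tilde g=g(\cdot,J\cdot)$. $\nabla$ is the Levi-Civita connection of $g$ and $R(X,Y)=[\nabla_X,\nabla_Y]-\nabla_{[X,Y]}$; flat means $R=0$. Lifts: local coordinates $(x^i)$ on $M$ induce coordinates $(x^i,y^i)$ on $TM$, where $(y^i)$ are the components of a tangent vector with respect to $\partial/\partial x^i$. For a vector field $X=X^k\,\partial/\partial x^k$ on $M$, $X^V=X^k\,\partial/\partial y^k$ and $X^H=X^k\,\partial/\partial x^k-y^i\Gamma_{ij}^kX^j\,\partial/\partial y^k$, where $\Gamma_{ij}^k$ are the components of $\nabla$. On $TM$: $J_1X^H=X^V$, $J_1X^V=-X^H$. Sasaki metric: $\hat g(X^H,Y^H)=\hat g(X^V,Y^V)=g(X,Y)$, $\hat g(X^H,Y^V)=0$; its Levi-Civita connection is $\hat\nabla$. The metric $\hat g$ (indefinite) is Hermitian with respect to $J_1$: $\hat g(J_1\cdot,J_1\cdot)=\hat g$. Put $\hat\Phi=\hat g(J_1\cdot,\cdot)$ and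 $F_1(A,B,C)=\hat g((\hat\nabla_AJ_1)B,C)$. $(TM,J_1,\hat g)$ is almost Kähler if $d\hat\Phi=0$ (equivalently, the cyclic sum of $F_1$ over its three arguments vanishes), and Kähler if $F_1=0$. *)

theory Defs
  imports "HOL-Analysis.Analysis"
begin

text \<open>\<open>Ck_on k S f\<close> is meant for open \<open>S\<close>; all iterated directional derivatives up to order
  \<open>k\<close> exist and are continuous.\<close>

primrec Ck_on :: "nat \<Rightarrow> 'a::real_normed_vector set \<Rightarrow> ('a \<Rightarrow> 'b::real_normed_vector) \<Rightarrow> bool" where
  "Ck_on 0 S f \<longleftrightarrow> continuous_on S f"
| "Ck_on (Suc k) S f \<longleftrightarrow>
     (\<forall>x\<in>S. f differentiable (at x)) \<and> (\<forall>v. Ck_on k S (\<lambda>x. frechet_derivative f (at x) v))"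

definition smooth_on :: "'a::real_normed_vector set \<Rightarrow> ('a \<Rightarrow> 'b::real_normed_vector) \<Rightarrow> bool" where
  "smooth_on S f \<longleftrightarrow> (\<forall>k. Ck_on k S f)"

text \<open>A space with an indexed family of charts with values in a Euclidean model space \<open>'e\<close>.
  Tensor fields are given classically, by their components in every chart \<open>i\<close>, as functions on the
  chart image that obey the transformation law; the vector fields in \<open>flat\<close>, \<open>almost_kaehler\<close> and
  \<open>kaehler\<close> are smooth fields over a chart domain. The model space is used without choosing a basis: a vector \<open>u :: 'e\<close> stands for the coordinate vector \<open>(u\<^sup>1, \<dots>, u\<^sup>m)\<close>. What a
  component function does off the image of its chart is irrelevant.\<close>

record ('a, 'i, 'e) atlas =
  mtop :: "'a topology"
  idx :: "'i set"
  cdom :: "'i \<Rightarrow> 'a set"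
  chart :: "'i \<Rightarrow> 'a \<Rightarrow> 'e"

definition cimg :: "('a, 'i, 'e::euclidean_space) atlas \<Rightarrow> 'i \<Rightarrow> 'e set" where
  "cimg M i = chart M i ` cdom M i"

definition overlap :: "('a, 'i, 'e::euclidean_space) atlas \<Rightarrow> 'i \<Rightarrow> 'i \<Rightarrow> 'e set" where
  "overlap M i j = chart M i ` (cdom M i \<inter> cdom M j)"

definition transition :: "('a, 'i, 'e::euclidean_space) atlas \<Rightarrow> 'i \<Rightarrow> 'i \<Rightarrow> 'e \<Rightarrow> 'e" where
  "transition M i j x = chart M j (inv_into (cdom M i) (chart M i) x)"

definition jacobian :: "('a, 'i, 'e::euclidean_space) atlas \<Rightarrow> 'i \<Rightarrow> 'i \<Rightarrow> 'e \<Rightarrow> 'e \<Rightarrow> 'e" where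
  "jacobian M i j x = frechet_derivative (transition M i j) (at x)"

definition smooth_manifold :: "('a, 'i, 'e::euclidean_space) atlas \<Rightarrow> bool" where
  "smooth_manifold M \<longleftrightarrow>
     Hausdorff_space (mtop M) \<and> second_countable (mtop M) \<and>
     (\<Union>i\<in>idx M. cdom M i) = topspace (mtop M) \<and>
     (\<forall>i\<in>idx M. openin (mtop M) (cdom M i) \<and> open (cimg M i) \<and>
        homeomorphic_map (subtopology (mtop M) (cdom M i)) (top_of_set (cimg M i)) (chart M i)) \<and>
     (\<forall>i\<in>idx M. \<forall>j\<in>idx M. smooth_on (overlap M i j) (transition M i j))"

definition tensor_0_2 ::
  "('a, 'i, 'e::euclidean_space) atlas \<Rightarrow> ('i \<Rightarrow> 'e \<Rightarrow> 'e \<Rightarrow> 'e \<Rightarrow> real) \<Rightarrow> bool" where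
  "tensor_0_2 M b \<longleftrightarrow>
     (\<forall>i\<in>idx M. (\<forall>x\<in>cimg M i. bilinear (b i x)) \<and> (\<forall>u v. smooth_on (cimg M i) (\<lambda>x. b i x u v))) \<and>
     (\<forall>i\<in>idx M. \<forall>j\<in>idx M. \<forall>x\<in>overlap M i j. \<forall>u v.
        b j (transition M i j x) (jacobian M i j x u) (jacobian M i j x v) = b i x u v)"

definition tensor_1_1 ::
  "('a, 'i, 'e::euclidean_space) atlas \<Rightarrow> ('i \<Rightarrow> 'e \<Rightarrow> 'e \<Rightarrow> 'e) \<Rightarrow> bool" where
  "tensor_1_1 M J \<longleftrightarrow>
     (\<forall>i\<in>idx M. (\<forall>x\<in>cimg M i. linear (J i x)) \<and> (\<forall>u. smooth_on (cimg M i) (\<lambda>x. J i x u))) \<and>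
     (\<forall>i\<in>idx M. \<forall>j\<in>idx M. \<forall>x\<in>overlap M i j. \<forall>u.
        J j (transition M i j x) (jacobian M i j x u) = jacobian M i j x (J i x u))"

definition almost_complex ::
  "('a, 'i, 'e::euclidean_space) atlas \<Rightarrow> ('i \<Rightarrow> 'e \<Rightarrow> 'e \<Rightarrow> 'e) \<Rightarrow> bool" where
  "almost_complex M J \<longleftrightarrow> tensor_1_1 M J \<and> (\<forall>i\<in>idx M. \<forall>x\<in>cimg M i. \<forall>u. J i x (J i x u) = - u)"

definition has_signature :: "('e::euclidean_space \<Rightarrow> 'e \<Rightarrow> real) \<Rightarrow> nat \<Rightarrow> nat \<Rightarrow> bool" where
  "has_signature b p q \<longleftrightarrow> p + q = DIM('e) \<and>
     (\<exists>P N. subspace P \<and> subspace N \<and> dim P = p \<and> dim N = q \<and>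
        (\<forall>u\<in>P. \<forall>v\<in>N. b u v = 0) \<and>
        (\<forall>u\<in>P - {0}. b u u > 0) \<and> (\<forall>v\<in>N - {0}. b v v < 0))"

definition pseudo_riemannian ::
  "('a, 'i, 'e::euclidean_space) atlas \<Rightarrow> ('i \<Rightarrow> 'e \<Rightarrow> 'e \<Rightarrow> 'e \<Rightarrow> real) \<Rightarrow> nat \<Rightarrow> nat \<Rightarrow> bool" where
  "pseudo_riemannian M g p q \<longleftrightarrow> tensor_0_2 M g \<and>
     (\<forall>i\<in>idx M. \<forall>x\<in>cimg M i. (\<forall>u v. g i x u v = g i x v u) \<and> has_signature (g i x) p q)"

text \<open>\<open>christoffel g x\<close> is the bilinear map \<open>(u, v) \<mapsto> \<Gamma>\<^sub>i\<^sub>j\<^sup>k(x) u\<^sup>i v\<^sup>j\<close> of the Levi-Civita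
  connection of \<open>g\<close>: the unique one which is torsion-free (symmetry, as coordinate fields commute)
  and satisfies \<open>\<nabla>g = 0\<close>.\<close>

definition christoffel ::
  "('e::euclidean_space \<Rightarrow> 'e \<Rightarrow> 'e \<Rightarrow> real) \<Rightarrow> 'e \<Rightarrow> 'e \<Rightarrow> 'e \<Rightarrow> 'e" where
  "christoffel g x = (THE G. bilinear G \<and> (\<forall>u v. G u v = G v u) \<and>
     (\<forall>u v w. frechet_derivative (\<lambda>z. g z u v) (at x) w = g x (G w u) v + g x u (G w v)))"

definition dirderiv ::
  "('e::euclidean_space \<Rightarrow> 'e) \<Rightarrow> ('e \<Rightarrow> 'b::real_normed_vector) \<Rightarrow> 'e \<Rightarrow> 'b" where
  "dirderiv X f = (\<lambda>x. frechet_derivative f (at x) (X x))"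

definition lie_bracket ::
  "('e::euclidean_space \<Rightarrow> 'e) \<Rightarrow> ('e \<Rightarrow> 'e) \<Rightarrow> 'e \<Rightarrow> 'e" where
  "lie_bracket X Y = (\<lambda>x. dirderiv X Y x - dirderiv Y X x)"

definition covderiv ::
  "('e::euclidean_space \<Rightarrow> 'e \<Rightarrow> 'e \<Rightarrow> real) \<Rightarrow> ('e \<Rightarrow> 'e) \<Rightarrow> ('e \<Rightarrow> 'e) \<Rightarrow> 'e \<Rightarrow> 'e" where
  "covderiv g X Y = (\<lambda>x. dirderiv X Y x + christoffel g x (X x) (Y x))"

definition curvature ::
  "('e::euclidean_space \<Rightarrow> 'e \<Rightarrow> 'e \<Rightarrow> real) \<Rightarrow> ('e \<Rightarrow> 'e) \<Rightarrow> ('e \<Rightarrow> 'e) \<Rightarrow> ('e \<Rightarrow> 'e) \<Rightarrow> 'e \<Rightarrow> 'e" where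
  "curvature g X Y Z = (\<lambda>x. covderiv g X (covderiv g Y Z) x - covderiv g Y (covderiv g X Z) x
     - covderiv g (lie_bracket X Y) Z x)"

definition covderiv_1_1 ::
  "('e::euclidean_space \<Rightarrow> 'e \<Rightarrow> 'e \<Rightarrow> real) \<Rightarrow> ('e \<Rightarrow> 'e \<Rightarrow> 'e) \<Rightarrow> ('e \<Rightarrow> 'e) \<Rightarrow> ('e \<Rightarrow> 'e) \<Rightarrow> 'e \<Rightarrow> 'e" where
  "covderiv_1_1 g J A B = (\<lambda>x. covderiv g A (\<lambda>z. J z (B z)) x - J x (covderiv g A B x))"

definition ext_deriv_2 ::
  "('e::euclidean_space \<Rightarrow> 'e \<Rightarrow> 'e \<Rightarrow> real) \<Rightarrow> ('e \<Rightarrow> 'e) \<Rightarrow> ('e \<Rightarrow> 'e) \<Rightarrow> ('e \<Rightarrow> 'e) \<Rightarrow> 'e \<Rightarrow> real" where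
  "ext_deriv_2 \<omega> A B C = (\<lambda>x.
     dirderiv A (\<lambda>z. \<omega> z (B z) (C z)) x
     + dirderiv B (\<lambda>z. \<omega> z (C z) (A z)) x
     + dirderiv C (\<lambda>z. \<omega> z (A z) (B z)) x
     - \<omega> x (lie_bracket A B x) (C x)
     - \<omega> x (lie_bracket B C x) (A x)
     - \<omega> x (lie_bracket C A x) (B x))"

definition flat ::
  "('a, 'i, 'e::euclidean_space) atlas \<Rightarrow> ('i \<Rightarrow> 'e \<Rightarrow> 'e \<Rightarrow> 'e \<Rightarrow> real) \<Rightarrow> bool" where
  "flat M g \<longleftrightarrow> (\<forall>i\<in>idx M. \<forall>X Y Z.
     smooth_on (cimg M i) X \<and> smooth_on (cimg M i) Y \<and> smooth_on (cimg M i) Z \<longrightarrow>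
     (\<forall>x\<in>cimg M i. curvature (g i) X Y Z x = 0))"

definition almost_skew_hermitian ::
  "nat \<Rightarrow> ('a, 'i, 'e::euclidean_space) atlas \<Rightarrow> ('i \<Rightarrow> 'e \<Rightarrow> 'e \<Rightarrow> 'e) \<Rightarrow>
   ('i \<Rightarrow> 'e \<Rightarrow> 'e \<Rightarrow> 'e \<Rightarrow> real) \<Rightarrow> ('i \<Rightarrow> 'e \<Rightarrow> 'e \<Rightarrow> 'e \<Rightarrow> real) \<Rightarrow> bool" where
  "almost_skew_hermitian n M J g gt \<longleftrightarrow> DIM('e) = 2 * n \<and>
     smooth_manifold M \<and> almost_complex M J \<and> pseudo_riemannian M g n n \<and>
     (\<forall>i\<in>idx M. \<forall>x\<in>cimg M i. \<forall>u v.
        g i x (J i x u) (J i x v) = - g i x u v \<and> gt i x u v = g i x u (J i x v))"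

text \<open>Metrics of arbitrary signature, the same at all points, are allowed here.\<close>

definition almost_hermitian ::
  "('a, 'i, 'e::euclidean_space) atlas \<Rightarrow> ('i \<Rightarrow> 'e \<Rightarrow> 'e \<Rightarrow> 'e) \<Rightarrow>
   ('i \<Rightarrow> 'e \<Rightarrow> 'e \<Rightarrow> 'e \<Rightarrow> real) \<Rightarrow> bool" where
  "almost_hermitian M J h \<longleftrightarrow>
     smooth_manifold M \<and> almost_complex M J \<and> (\<exists>p q. pseudo_riemannian M h p q) \<and>
     (\<forall>i\<in>idx M. \<forall>x\<in>cimg M i. \<forall>u v. h i x (J i x u) (J i x v) = h i x u v)"

definition fundamental_form ::
  "('i \<Rightarrow> 'e \<Rightarrow> 'e \<Rightarrow> 'e) \<Rightarrow> ('i \<Rightarrow> 'e \<Rightarrow> 'e \<Rightarrow> 'e \<Rightarrow> real) \<Rightarrow> 'i \<Rightarrow> 'e \<Rightarrow> 'e \<Rightarrow> 'e \<Rightarrow> real" where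
  "fundamental_form J h i x u v = h i x (J i x u) v"

definition almost_kaehler ::
  "('a, 'i, 'e::euclidean_space) atlas \<Rightarrow> ('i \<Rightarrow> 'e \<Rightarrow> 'e \<Rightarrow> 'e) \<Rightarrow>
   ('i \<Rightarrow> 'e \<Rightarrow> 'e \<Rightarrow> 'e \<Rightarrow> real) \<Rightarrow> bool" where
  "almost_kaehler M J h \<longleftrightarrow> almost_hermitian M J h \<and>
     (\<forall>i\<in>idx M. \<forall>A B C.
        smooth_on (cimg M i) A \<and> smooth_on (cimg M i) B \<and> smooth_on (cimg M i) C \<longrightarrow>
        (\<forall>x\<in>cimg M i. ext_deriv_2 (fundamental_form J h i) A B C x = 0))"

definition kaehler ::
  "('a, 'i, 'e::euclidean_space) atlas \<Rightarrow> ('i \<Rightarrow> 'e \<Rightarrow> 'e \<Rightarrow> 'e) \<Rightarrow>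
   ('i \<Rightarrow> 'e \<Rightarrow> 'e \<Rightarrow> 'e \<Rightarrow> real) \<Rightarrow> bool" where
  "kaehler M J h \<longleftrightarrow> almost_hermitian M J h \<and>
     (\<forall>i\<in>idx M. \<forall>A B C.
        smooth_on (cimg M i) A \<and> smooth_on (cimg M i) B \<and> smooth_on (cimg M i) C \<longrightarrow>
        (\<forall>x\<in>cimg M i. h i x (covderiv_1_1 (h i) (J i) A B x) (C x) = 0))"

text \<open>A tangent vector at \<open>p\<close> is the family of its component vectors in all charts around \<open>p\<close>,
  which transform by the Jacobian. The entries at the other indices are set to \<open>0\<close> so that
  equality of tangent vectors is equality of families.\<close>

definition tangent_vectors :: "('a, 'i, 'e::euclidean_space) atlas \<Rightarrow> ('a \<times> ('i \<Rightarrow> 'e)) set" where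
  "tangent_vectors M = {(p, v). p \<in> topspace (mtop M) \<and>
     (\<forall>i\<in>idx M. \<forall>j\<in>idx M. p \<in> cdom M i \<inter> cdom M j \<longrightarrow> v j = jacobian M i j (chart M i p) (v i)) \<and>
     (\<forall>i. \<not> (i \<in> idx M \<and> p \<in> cdom M i) \<longrightarrow> v i = 0)}"

definition tb_cdom :: "('a, 'i, 'e::euclidean_space) atlas \<Rightarrow> 'i \<Rightarrow> ('a \<times> ('i \<Rightarrow> 'e)) set" where
  "tb_cdom M i = {(p, v) \<in> tangent_vectors M. p \<in> cdom M i}"

definition tb_chart ::
  "('a, 'i, 'e::euclidean_space) atlas \<Rightarrow> 'i \<Rightarrow> 'a \<times> ('i \<Rightarrow> 'e) \<Rightarrow> 'e \<times> 'e" where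
  "tb_chart M i = (\<lambda>(p, v). (chart M i p, v i))"

text \<open>The topology is the coarsest one in which the induced chart domains are open and the induced
  charts \<open>(x\<^sup>i, y\<^sup>i)\<close> are continuous on them.\<close>

definition tangent_bundle ::
  "('a, 'i, 'e::euclidean_space) atlas \<Rightarrow> ('a \<times> ('i \<Rightarrow> 'e), 'i, 'e \<times> 'e) atlas" where
  "tangent_bundle M =
     \<lparr> mtop = topology_generated_by
         {{w \<in> tb_cdom M i. tb_chart M i w \<in> W} | i W. i \<in> idx M \<and> open W},
       idx = idx M, cdom = tb_cdom M, chart = tb_chart M \<rparr>"

text \<open>Below, \<open>G\<close> stands for the Christoffel map at the base point and \<open>y\<close> for the fibre coordinate
  of the point of the bundle. A pair \<open>(a, b)\<close> is the tangent vector
  \<open>a\<^sup>k \<partial>/\<partial>x\<^sup>k + b\<^sup>k \<partial>/\<partial>y\<^sup>k\<close>.\<close>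

definition hor_lift :: "('e::euclidean_space \<Rightarrow> 'e \<Rightarrow> 'e) \<Rightarrow> 'e \<Rightarrow> 'e \<Rightarrow> 'e \<times> 'e" where
  "hor_lift G y X = (X, - G y X)"

definition ver_lift :: "'e::euclidean_space \<Rightarrow> 'e \<times> 'e" where
  "ver_lift X = (0, X)"

text \<open>Every tangent vector of the bundle is uniquely \<open>X\<^sup>H + Z\<^sup>V\<close>; its parts \<open>X\<close> and \<open>Z\<close> are the
  following (lemma \<open>lift_decomposition\<close>).\<close>

definition hor_part :: "'e \<times> 'e \<Rightarrow> 'e::euclidean_space" where
  "hor_part A = fst A"

definition ver_part :: "('e::euclidean_space \<Rightarrow> 'e \<Rightarrow> 'e) \<Rightarrow> 'e \<Rightarrow> 'e \<times> 'e \<Rightarrow> 'e" where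
  "ver_part G y A = snd A + G y (fst A)"

definition tb_J1 ::
  "('i \<Rightarrow> 'e::euclidean_space \<Rightarrow> 'e \<Rightarrow> 'e \<Rightarrow> real) \<Rightarrow> 'i \<Rightarrow> 'e \<times> 'e \<Rightarrow> 'e \<times> 'e \<Rightarrow> 'e \<times> 'e" where
  "tb_J1 g i = (\<lambda>(x, y) A. let G = christoffel (g i) x in
     ver_lift (hor_part A) - hor_lift G y (ver_part G y A))"

definition sasaki ::
  "('i \<Rightarrow> 'e::euclidean_space \<Rightarrow> 'e \<Rightarrow> 'e \<Rightarrow> real) \<Rightarrow> 'i \<Rightarrow> 'e \<times> 'e \<Rightarrow> 'e \<times> 'e \<Rightarrow> 'e \<times> 'e \<Rightarrow> real" where
  "sasaki g i = (\<lambda>(x, y) A B. let G = christoffel (g i) x in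
     g i x (hor_part A) (hor_part B) + g i x (ver_part G y A) (ver_part G y B))"

lemma nondegenerate_representation:
  fixes b :: "'e::euclidean_space \<Rightarrow> 'e \<Rightarrow> real"
  assumes b: "bilinear b" and nd: "\<And>w. (\<And>z. b w z = 0) \<Longrightarrow> w = 0" and f: "linear f"
  shows "\<exists>!w. \<forall>z. b w z = f z"
proof -
  define L where "L w = (\<Sum>e\<in>Basis. b w e *\<^sub>R e)" for w
  have lin: "linear L"
    unfolding L_def
    by (rule linearI) (simp_all add: bilinear_ladd[OF b] bilinear_lmul[OF b] scaleR_add_left
        sum.distrib scaleR_sum_right)
  have ext: "b w z = f z" if "\<forall>e\<in>Basis. b w e = f e" for w z
  proof -
    have "linear (b w)" using b by (simp add: bilinear_def)
    then show ?thesis using that f linear_eq_on_span[of "b w" f Basis z] by auto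
  qed
  have Le: "L w \<bullet> e = b w e" if "e \<in> Basis" for w e
    unfolding L_def using that by (simp add: inner_sum_left inner_Basis if_distrib cong: if_cong)
  have "inj L"
  proof (subst linear_injective_0[OF lin], intro allI impI)
    fix w assume "L w = 0"
    then have "\<forall>e\<in>Basis. b w e = 0" using Le by (metis inner_zero_left)
    moreover have "linear (b w)" using b by (simp add: bilinear_def)
    ultimately have "b w z = 0" for z
      using linear_eq_on_span[of "b w" "\<lambda>_. 0" Basis z] by (auto simp: linear_zero)
    then show "w = 0" by (rule nd)
  qed
  then have "surj L" using lin linear_injective_imp_surjective by blast
  then obtain w where w: "L w = (\<Sum>e\<in>Basis. f e *\<^sub>R e)" by (metis surjD)
  have "\<forall>e\<in>Basis. b w e = f e"
  proof
    fix e :: 'e assume e: "e \<in> Basis"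
    have "L w \<bullet> e = f e"
      unfolding w using e by (simp add: inner_sum_left inner_Basis if_distrib cong: if_cong)
    then show "b w e = f e" using Le[OF e] by simp
  qed
  then have ex: "\<forall>z. b w z = f z" using ext by blast
  moreover have "w' = w" if "\<forall>z. b w' z = f z" for w'
  proof -
    have "b (w' - w) z = 0" for z using that ex by (simp add: bilinear_lsub[OF b])
    then show ?thesis using nd[of "w' - w"] by simp
  qed
  ultimately show ?thesis by blast
qed

text \<open>The description of \<open>christoffel g x\<close> is proper: existence and uniqueness of the
  Levi-Civita connection, via the Koszul formula.\<close>

lemma christoffel_exists1:
  fixes g :: "'e::euclidean_space \<Rightarrow> 'e \<Rightarrow> 'e \<Rightarrow> real"
  assumes S: "open S" "x \<in> S"
    and bil: "\<And>z. z \<in> S \<Longrightarrow> bilinear (g z)"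
    and sym: "\<And>z u v. z \<in> S \<Longrightarrow> g z u v = g z v u"
    and diff: "\<And>u v. (\<lambda>z. g z u v) differentiable (at x)"
    and nd: "\<And>w. (\<And>z. g x w z = 0) \<Longrightarrow> w = 0"
  shows "\<exists>!G. bilinear G \<and> (\<forall>u v. G u v = G v u) \<and>
     (\<forall>u v w. frechet_derivative (\<lambda>z. g z u v) (at x) w = g x (G w u) v + g x u (G w v))"
proof -
  define D where "D u v = frechet_derivative (\<lambda>z. g z u v) (at x)" for u v
  have der: "((\<lambda>z. g z u v) has_derivative D u v) (at x)" for u v
    unfolding D_def using diff frechet_derivative_works by blast
  have linD: "linear (D u v)" for u v
    using der has_derivative_linear by blast
  have D_eqI: "D u v = d" if "(f has_derivative d) (at x)" and "\<And>z. z \<in> S \<Longrightarrow> f z = g z u v" for u v f d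
    using has_derivative_transform_within_open[OF that(1) S that(2)] der has_derivative_unique by blast
  have D_sym: "D u v w = D v u w" for u v w
    using D_eqI[OF der[of v u], of u v] sym by simp
  have D_add: "D (u + u') v w = D u v w + D u' v w" for u u' v w
    using D_eqI[OF has_derivative_add[OF der[of u v] der[of u' v]], of "u + u'" v]
    by (simp add: bilinear_ladd[OF bil])
  have D_mul: "D (c *\<^sub>R u) v w = c * D u v w" for c u v w
    using D_eqI[OF has_derivative_mult_right[OF der[of u v], of c], of "c *\<^sub>R u" v]
    by (simp add: bilinear_lmul[OF bil])
  have D_add2: "D v (u + u') w = D v u w + D v u' w" for u u' v w
    using D_add D_sym by metis
  have D_mul2: "D v (c *\<^sub>R u) w = c * D v u w" for c u v w
    using D_mul D_sym by metis
  have D_add3: "D u v (w + w') = D u v w + D u v w'" for u v w w'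
    using linD linear_add by blast
  have D_mul3: "D u v (c *\<^sub>R w) = c * D u v w" for c u v w
    using linear_scale[OF linD] by simp
  note Dlin = D_add D_mul D_add2 D_mul2 D_add3 D_mul3
  have b: "bilinear (g x)" using bil S by blast
  have bs: "g x u v = g x v u" for u v using sym S by blast
  define K where "K u v z = (D v z u + D u z v - D u v z) / 2" for u v z
  have "linear (K u v)" for u v
    by (rule linearI) (simp_all add: K_def Dlin field_simps)
  then have ex1: "\<exists>!w. \<forall>z. g x w z = K u v z" for u v
    using nondegenerate_representation[OF b] nd by blast
  define G where "G u v = (THE w. \<forall>z. g x w z = K u v z)" for u v
  have G: "g x (G u v) z = K u v z" for u v z
    unfolding G_def using theI'[OF ex1] by blast
  have eqI: "w = w'" if "\<And>z. g x w z = g x w' z" for w w'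
    using nd[of "w - w'"] that by (simp add: bilinear_lsub[OF b])
  have Gsym: "G u v = G v u" for u v
    by (rule eqI) (use D_sym[of u v] in \<open>simp add: G K_def algebra_simps\<close>)
  have Glin: "linear (G u)" for u
    by (rule linearI; rule eqI)
       (simp_all add: G K_def bilinear_ladd[OF b] bilinear_lmul[OF b] Dlin field_simps)
  have "bilinear G"
    unfolding bilinear_def using Glin Gsym by simp
  moreover have "D u v w = g x (G w u) v + g x u (G w v)" for u v w
    using D_sym[of u v w] D_sym[of v w u] D_sym[of u w v] bs[of u "G w v"]
    by (simp add: G K_def field_simps)
  moreover have "G' = G" if bil': "bilinear G'" and s: "\<forall>u v. G' u v = G' v u"
    and m: "\<forall>u v w. D u v w = g x (G' w u) v + g x u (G' w v)" for G'
  proof (intro ext eqI)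
    fix u v z
    have "D v z u = g x (G' u v) z + g x (G' u z) v" "D u z v = g x (G' u v) z + g x (G' v z) u"
      "D u v z = g x (G' u z) v + g x (G' v z) u"
      using m s bs by metis+
    then show "g x (G' u v) z = g x (G u v) z" by (simp add: G K_def)
  qed
  ultimately have "\<exists>!G. bilinear G \<and> (\<forall>u v. G u v = G v u) \<and>
     (\<forall>u v w. D u v w = g x (G w u) v + g x u (G w v))"
    using Gsym by (intro ex1I[of _ G]) blast+
  then show ?thesis unfolding D_def .
qed

lemma lift_decomposition:
  "A = hor_lift G y X + ver_lift Z \<longleftrightarrow> X = hor_part A \<and> Z = ver_part G y A"
  by (cases A) (auto simp: hor_lift_def ver_lift_def hor_part_def ver_part_def)

lemma tb_J1_lifts:
  assumes "bilinear (christoffel (g i) x)"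
  shows "tb_J1 g i (x, y) (hor_lift (christoffel (g i) x) y X) = ver_lift X"
    and "tb_J1 g i (x, y) (ver_lift X) = - hor_lift (christoffel (g i) x) y X"
  by (simp_all add: tb_J1_def Let_def hor_lift_def ver_lift_def hor_part_def ver_part_def
      bilinear_rzero[OF assms])

lemma sasaki_lifts:
  assumes "bilinear (christoffel (g i) x)" and "bilinear (g i x)"
  shows "sasaki g i (x, y) (hor_lift (christoffel (g i) x) y X) (hor_lift (christoffel (g i) x) y Y) = g i x X Y"
    and "sasaki g i (x, y) (ver_lift X) (ver_lift Y) = g i x X Y"
    and "sasaki g i (x, y) (hor_lift (christoffel (g i) x) y X) (ver_lift Y) = 0"
  by (simp_all add: sasaki_def Let_def hor_lift_def ver_lift_def hor_part_def ver_part_def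
      bilinear_rzero[OF assms(1)] bilinear_rzero[OF assms(2)] bilinear_lzero[OF assms(2)])

end

theory Submission
  imports Defs
begin

text \<open>Split a tangent vector \<open>A\<close> of \<open>TM\<close> at \<open>(x, y)\<close> into its horizontal part \<open>HA\<close> and its vertical part
  \<open>VA\<close>, both vectors of \<open>M\<close> at \<open>x\<close>. In these terms \<open>J\<^sub>1\<close> is \<open>(HA, VA) \<mapsto> (-VA, HA)\<close> and the Sasaki metric is
  \<open>g(HA, HB) + g(VA, VB)\<close>.

  The fundamental form is closed because it is exact. The metric turns the Liouville form of the cotangent
  bundle into the 1-form \<open>A \<mapsto> g(y, HA)\<close> on \<open>TM\<close>. Its differential, computed with \<open>\<nabla>g = 0\<close> and the symmetry of
  the Christoffel symbols, is \<open>g(VA, HB) - g(VB, HA)\<close>, the negative of the fundamental form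
  (lemmas \<open>fundamental_form_closed\<close> and \<open>ext_deriv_2_exact\<close>).

  For the Kaehler condition, \<open>\<nabla>\<close> acts on both summands of the splitting and so gives a connection on \<open>TM\<close>
  (the constant \<open>adapted\<close>). It preserves the Sasaki metric and \<open>J\<^sub>1\<close>, since both have constant coefficients
  with respect to the splitting, but it has torsion: at \<open>(x, y)\<close> the torsion of \<open>A\<close> and \<open>B\<close> is the vertical
  vector \<open>R(HA, HB)y\<close> (lemmas \<open>adapted_metric\<close>, \<open>adapted_J1\<close>, \<open>adapted_torsion\<close>). The Levi-Civita connection of
  the Sasaki metric differs from it by the contorsion, a fixed linear combination of torsion terms
  (lemma \<open>contorsion_eq\<close>), and the covariant derivative of \<open>J\<^sub>1\<close> is an expression in the contorsion alone
  (lemma \<open>covderiv_J1\<close>). If \<open>R = 0\<close>, everything vanishes. Conversely, evaluating the Kaehler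
  condition at \<open>(x, y)\<close> on a vertical vector \<open>A\<close>, a horizontal one \<open>B\<close> and a vertical one \<open>C\<close> leaves, up to a
  nonzero factor, the single term \<open>g(R(HB, VC)y, VA)\<close>; as \<open>y\<close>, \<open>HB\<close>, \<open>VC\<close> and \<open>VA\<close> are arbitrary and \<open>g\<close> is nondegenerate, \<open>R = 0\<close>
  (lemma \<open>kaehler_iff\<close>).

  These arguments are local. Around them lies the proof that \<open>TM\<close> with these data is an almost Hermitian
  manifold. Its topology is handled through the bundle charts (lemma \<open>smooth_manifold_TM\<close>). Smoothness of the
  data needs smooth Christoffel symbols, which hold because by the Koszul formula they solve a linear system
  with smooth coefficients (lemma \<open>christoffel_smooth\<close>). Independence of the chart rests on the transformation
  law of the Christoffel symbols (lemma \<open>christoffel_transform\<close>), whose inhomogeneous term, the Hessian of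
  the transition map, cancels against the second derivatives in the Jacobian of the bundle transition
  (lemma \<open>ver_transform\<close>), so that horizontal and vertical parts transform as vectors of \<open>M\<close>.\<close>

section \<open>Smooth maps on open sets\<close>

lemma Ck_on_differentiable: "Ck_on (Suc k) S f \<Longrightarrow> x \<in> S \<Longrightarrow> f differentiable (at x)"
  by simp

lemma Ck_on_Suc_continuous: "Ck_on (Suc k) S f \<Longrightarrow> continuous_on S f"
  by (simp add: continuous_at_imp_continuous_on differentiable_imp_continuous_within)

lemma Ck_on_pred: "Ck_on (Suc k) S f \<Longrightarrow> Ck_on k S f"
proof (induction k arbitrary: f)
  case 0
  then show ?case using Ck_on_Suc_continuous[of 0 S f] by simp
next
  case (Suc k)
  then show ?case by (metis Ck_on.simps(2))
qed

lemma Ck_on_cong: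
  assumes "open S" "\<And>x. x \<in> S \<Longrightarrow> f x = g x"
  shows "Ck_on k S f \<longleftrightarrow> Ck_on k S g"
  using assms(2)
proof (induction k arbitrary: f g)
  case 0
  then show ?case by (simp cong: continuous_on_cong)
next
  case (Suc k)
  have d: "f differentiable (at x) \<longleftrightarrow> g differentiable (at x)" if "x \<in> S" for x
    using that Suc.prems assms(1) unfolding differentiable_def
    by (metis (no_types, lifting) has_derivative_transform_within_open)
  have e: "frechet_derivative f (at x) = frechet_derivative g (at x)"
    if "x \<in> S" "f differentiable (at x)" for x
    using frechet_derivative_transform_within_open[OF that(2) assms(1) that(1)] Suc.prems by blast
  show ?case
  proof (cases "\<forall>x\<in>S. f differentiable (at x)")
    case True
    then have "Ck_on k S (\<lambda>x. frechet_derivative f (at x) v) \<longleftrightarrow>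
        Ck_on k S (\<lambda>x. frechet_derivative g (at x) v)" for v
      using e by (intro Suc.IH) simp
    then show ?thesis using d by simp
  qed (use d in auto)
qed

text \<open>The form in which membership is checked below: the derivative may be any function found by the
  differentiation rules, and the choice operator inside \<open>frechet_derivative\<close> stays out of sight.\<close>

lemma Ck_on_SucI:
  assumes "open S" "\<And>x. x \<in> S \<Longrightarrow> (f has_derivative f' x) (at x)" "\<And>v. Ck_on k S (\<lambda>x. f' x v)"
  shows "Ck_on (Suc k) S f"
proof -
  have "f' x = frechet_derivative f (at x)" if "x \<in> S" for x
    using assms(2)[OF that] by (rule frechet_derivative_at)
  then have "Ck_on k S (\<lambda>x. frechet_derivative f (at x) v)" for v
    using assms(3)[of v] Ck_on_cong[OF assms(1), of "\<lambda>x. f' x v"] by simp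
  then show ?thesis using assms(2) by (auto simp: differentiable_def)
qed

lemma Ck_on_const: "Ck_on k S (\<lambda>x. c)"
  by (induction k arbitrary: c) auto

lemma Ck_on_bounded_linear_comp:
  assumes S: "open S" and L: "bounded_linear L"
  shows "Ck_on k S f \<Longrightarrow> Ck_on k S (\<lambda>x. L (f x))"
proof (induction k arbitrary: f)
  case 0
  then show ?case using bounded_linear.continuous_on[OF L] by simp
next
  case (Suc k)
  show ?case
  proof (rule Ck_on_SucI[OF S])
    show "((\<lambda>x. L (f x)) has_derivative (\<lambda>v. L (frechet_derivative f (at x) v))) (at x)" if "x \<in> S" for x
      using Suc.prems that bounded_linear.has_derivative[OF L] frechet_derivative_works
      by (metis Ck_on_differentiable)
    show "Ck_on k S (\<lambda>x. L (frechet_derivative f (at x) v))" for v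
      using Suc.prems by (intro Suc.IH) simp
  qed
qed

lemma Ck_on_add:
  assumes S: "open S"
  shows "Ck_on k S f \<Longrightarrow> Ck_on k S g \<Longrightarrow> Ck_on k S (\<lambda>x. f x + g x)"
proof (induction k arbitrary: f g)
  case 0
  then show ?case by (simp add: continuous_on_add)
next
  case (Suc k)
  show ?case
    by (rule Ck_on_SucI[OF S, where f' = "\<lambda>x v. frechet_derivative f (at x) v + frechet_derivative g (at x) v"])
       (use Suc in \<open>auto intro!: has_derivative_add simp: frechet_derivative_works[symmetric]\<close>)
qed

lemma Ck_on_sum:
  assumes S: "open S"
  shows "(\<And>i. i \<in> I \<Longrightarrow> Ck_on k S (f i)) \<Longrightarrow> Ck_on k S (\<lambda>x. \<Sum>i\<in>I. f i x)"
  by (induction I rule: infinite_finite_induct) (auto intro: Ck_on_const Ck_on_add[OF S])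

lemma Ck_on_bounded_bilinear:
  assumes S: "open S" and B: "bounded_bilinear B"
  shows "Ck_on k S f \<Longrightarrow> Ck_on k S g \<Longrightarrow> Ck_on k S (\<lambda>x. B (f x) (g x))"
proof (induction k arbitrary: f g)
  case 0
  then show ?case by (simp add: bounded_bilinear.continuous_on[OF B])
next
  case (Suc k)
  have k: "Ck_on k S f" "Ck_on k S g" using Suc.prems Ck_on_pred by blast+
  show ?case
  proof (rule Ck_on_SucI[OF S])
    fix x assume "x \<in> S"
    then show "((\<lambda>x. B (f x) (g x)) has_derivative
      (\<lambda>v. B (f x) (frechet_derivative g (at x) v) + B (frechet_derivative f (at x) v) (g x))) (at x)"
      using Suc.prems by (intro bounded_bilinear.FDERIV[OF B]) (simp_all add: frechet_derivative_works[symmetric])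
  next
    show "Ck_on k S (\<lambda>x. B (f x) (frechet_derivative g (at x) v) + B (frechet_derivative f (at x) v) (g x))" for v
      using Suc.prems k by (intro Ck_on_add[OF S] Suc.IH) auto
  qed
qed

text \<open>Expanding in the basis reduces statements on families of linear maps to statements on finitely many
  products.\<close>

lemma euclidean_linear_sum:
  fixes L :: "'a::euclidean_space \<Rightarrow> 'b::real_vector"
  assumes "linear L"
  shows "L v = (\<Sum>e\<in>Basis. (v \<bullet> e) *\<^sub>R L e)"
  by (subst euclidean_representation[of v, symmetric])
     (simp only: linear_sum[OF assms] linear_scale[OF assms])

lemma smooth_on_Ck: "smooth_on S f \<Longrightarrow> Ck_on k S f"
  by (simp add: smooth_on_def)

lemma smooth_on_differentiable: "smooth_on S f \<Longrightarrow> x \<in> S \<Longrightarrow> f differentiable (at x)"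
  using smooth_on_Ck Ck_on_differentiable by blast

lemma smooth_on_has_derivative:
  "smooth_on S f \<Longrightarrow> x \<in> S \<Longrightarrow> (f has_derivative frechet_derivative f (at x)) (at x)"
  using smooth_on_differentiable frechet_derivative_works by blast

lemma smooth_on_continuous: "smooth_on S f \<Longrightarrow> continuous_on S f"
  using smooth_on_Ck[of S f 0] by simp

lemma smooth_on_frechet: "smooth_on S f \<Longrightarrow> smooth_on S (\<lambda>x. frechet_derivative f (at x) v)"
  unfolding smooth_on_def by (metis Ck_on.simps(2))

lemma smooth_on_const [simp, intro]: "smooth_on S (\<lambda>x. c)"
  by (simp add: smooth_on_def Ck_on_const)

lemma smooth_on_cong: "open S \<Longrightarrow> (\<And>x. x \<in> S \<Longrightarrow> f x = g x) \<Longrightarrow> smooth_on S f \<longleftrightarrow> smooth_on S g"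
  unfolding smooth_on_def using Ck_on_cong by blast

lemma smooth_on_bounded_linear_comp:
  "open S \<Longrightarrow> bounded_linear L \<Longrightarrow> smooth_on S f \<Longrightarrow> smooth_on S (\<lambda>x. L (f x))"
  by (simp add: smooth_on_def Ck_on_bounded_linear_comp)

lemma smooth_on_ident: "open S \<Longrightarrow> smooth_on S (\<lambda>x. x)"
proof -
  assume S: "open S"
  have "Ck_on k S (\<lambda>x. x)" for k
  proof (cases k)
    case (Suc m)
    then show ?thesis by (auto intro!: Ck_on_SucI[OF S has_derivative_ident] Ck_on_const)
  qed simp
  then show ?thesis by (simp add: smooth_on_def)
qed

lemma smooth_on_bounded_linear: "open S \<Longrightarrow> bounded_linear L \<Longrightarrow> smooth_on S L"
  using smooth_on_bounded_linear_comp[OF _ _ smooth_on_ident] by blast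

lemma smooth_on_add: "open S \<Longrightarrow> smooth_on S f \<Longrightarrow> smooth_on S g \<Longrightarrow> smooth_on S (\<lambda>x. f x + g x)"
  by (simp add: smooth_on_def Ck_on_add)

lemma smooth_on_sum: "open S \<Longrightarrow> (\<And>i. i \<in> I \<Longrightarrow> smooth_on S (f i)) \<Longrightarrow> smooth_on S (\<lambda>x. \<Sum>i\<in>I. f i x)"
  by (simp add: smooth_on_def Ck_on_sum)

lemma smooth_on_bounded_bilinear:
  "open S \<Longrightarrow> bounded_bilinear B \<Longrightarrow> smooth_on S f \<Longrightarrow> smooth_on S g \<Longrightarrow> smooth_on S (\<lambda>x. B (f x) (g x))"
  by (simp add: smooth_on_def Ck_on_bounded_bilinear)

lemmas smooth_on_scaleR = smooth_on_bounded_bilinear[OF _ bounded_bilinear_scaleR]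
lemmas smooth_on_mult = smooth_on_bounded_bilinear[OF _ bounded_bilinear_mult]
lemmas smooth_on_inner = smooth_on_bounded_bilinear[OF _ bounded_bilinear_inner]
lemmas smooth_on_minus = smooth_on_bounded_linear_comp[OF _ bounded_linear_minus[OF bounded_linear_ident]]

lemma smooth_on_diff:
  "open S \<Longrightarrow> smooth_on S f \<Longrightarrow> smooth_on S g \<Longrightarrow> smooth_on S (\<lambda>x. f x - g x)"
  using smooth_on_add[OF _ _ smooth_on_minus, of S f g] by simp

lemma smooth_on_Pair:
  assumes S: "open S" and "smooth_on S f" "smooth_on S g"
  shows "smooth_on S (\<lambda>x. (f x, g x))"
proof -
  have "bounded_linear (\<lambda>a. (a, 0::'c))" "bounded_linear (\<lambda>b. (0::'b, b))"
    by (intro bounded_linear_Pair bounded_linear_ident bounded_linear_zero)+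
  then have "smooth_on S (\<lambda>x. (f x, 0) + (0, g x))"
    using assms by (intro smooth_on_add[OF S] smooth_on_bounded_linear_comp[OF S, where L = "\<lambda>a. (a, 0)"]
        smooth_on_bounded_linear_comp[OF S, where L = "\<lambda>b. (0, b)"])
  then show ?thesis by simp
qed

text \<open>Induction on the order, for all \<open>f\<close> at once: by the chain rule and the expansion in the basis, a
  derivative of \<open>f \<circ> g\<close> is a sum of products of derivatives of \<open>g\<close> with functions \<open>f' \<circ> g\<close>, where \<open>f'\<close> is
  again a smooth function.\<close>

lemma smooth_on_compose:
  fixes f :: "'a::euclidean_space \<Rightarrow> 'b::real_normed_vector" and g :: "'c::real_normed_vector \<Rightarrow> 'a"
  assumes T: "open T" and S: "open S" and f: "smooth_on T f" and g: "smooth_on S g" and gS: "g ` S \<subseteq> T"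
  shows "smooth_on S (\<lambda>x. f (g x))"
proof -
  have "Ck_on k S (\<lambda>x. f (g x))" for k
    using f
  proof (induction k arbitrary: f)
    case 0
    then show ?case
      using continuous_on_compose2[OF smooth_on_continuous smooth_on_continuous[OF g] gS] by simp
  next
    case (Suc k)
    show ?case
    proof (rule Ck_on_SucI[OF S])
      fix x assume x: "x \<in> S"
      have der: "((\<lambda>x. f (g x)) has_derivative (\<lambda>v. frechet_derivative f (at (g x)) (frechet_derivative g (at x) v))) (at x)"
        using x gS by (intro has_derivative_compose[of g _ x UNIV f] smooth_on_has_derivative[OF g]
            smooth_on_has_derivative[OF Suc.prems]) auto
      have lin: "linear (frechet_derivative f (at (g x)))"
        using x gS by (intro linear_frechet_derivative smooth_on_differentiable[OF Suc.prems]) auto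
      show "((\<lambda>x. f (g x)) has_derivative
         (\<lambda>v. \<Sum>e\<in>Basis. (frechet_derivative g (at x) v \<bullet> e) *\<^sub>R frechet_derivative f (at (g x)) e)) (at x)"
        using der unfolding euclidean_linear_sum[OF lin, of "frechet_derivative g (at x) _"] .
    next
      fix v
      show "Ck_on k S (\<lambda>x. \<Sum>e\<in>Basis. (frechet_derivative g (at x) v \<bullet> e) *\<^sub>R frechet_derivative f (at (g x)) e)"
      proof (intro Ck_on_sum[OF S] Ck_on_bounded_bilinear[OF S bounded_bilinear_scaleR])
        fix e :: 'a
        show "Ck_on k S (\<lambda>x. frechet_derivative g (at x) v \<bullet> e)"
          by (rule smooth_on_Ck[OF smooth_on_inner[OF S smooth_on_frechet[OF g] smooth_on_const]])
        show "Ck_on k S (\<lambda>x. frechet_derivative f (at (g x)) e)"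
          by (rule Suc.IH[OF smooth_on_frechet[OF Suc.prems]])
      qed
    qed
  qed
  then show ?thesis by (simp add: smooth_on_def)
qed

text \<open>Tensor fields are smooth when their values on constant vectors are; this and the next lemmas pass from
  constant to varying vectors.\<close>

lemma smooth_on_linear_family:
  fixes L :: "'a::real_normed_vector \<Rightarrow> 'b::euclidean_space \<Rightarrow> 'c::real_normed_vector"
  assumes S: "open S" and lin: "\<And>x. x \<in> S \<Longrightarrow> linear (L x)"
    and L: "\<And>u. smooth_on S (\<lambda>x. L x u)" and f: "smooth_on S f"
  shows "smooth_on S (\<lambda>x. L x (f x))"
proof -
  have "smooth_on S (\<lambda>x. \<Sum>e\<in>Basis. (f x \<bullet> e) *\<^sub>R L x e)"
    by (rule smooth_on_sum[OF S], rule smooth_on_scaleR[OF S smooth_on_inner[OF S f smooth_on_const] L])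
  then show ?thesis
    by (subst smooth_on_cong[OF S euclidean_linear_sum]) (auto intro: lin)
qed

text \<open>The Leibniz rule for \<open>L x (f x)\<close>, where only the separate differentiability of each \<open>x \<mapsto> L x u\<close> is known.
  The linearity of \<open>u \<mapsto> D\<^sub>v (L \<cdot> u)\<close> makes it possible to collect the sum over the basis into a single term.\<close>

lemma linear_family_derivative:
  fixes L :: "'a::real_normed_vector \<Rightarrow> 'b::euclidean_space \<Rightarrow> 'c::real_normed_vector"
  assumes S: "open S" "x \<in> S" and lin: "\<And>x. x \<in> S \<Longrightarrow> linear (L x)"
    and L: "\<And>u. (\<lambda>x. L x u) differentiable (at x)" and f: "(f has_derivative f') (at x)"
  shows "linear (\<lambda>u. frechet_derivative (\<lambda>x. L x u) (at x) v)"
    and "((\<lambda>x. L x (f x)) has_derivative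
      (\<lambda>v. frechet_derivative (\<lambda>z. L z (f x)) (at x) v + L x (f' v))) (at x)"
proof -
  define D where "D u = frechet_derivative (\<lambda>z. L z u) (at x)" for u
  have der: "((\<lambda>z. L z u) has_derivative D u) (at x)" for u
    using L frechet_derivative_works unfolding D_def by blast
  have D_eqI: "D u = d" if "(h has_derivative d) (at x)" and "\<And>z. z \<in> S \<Longrightarrow> h z = L z u" for u h d
    using has_derivative_transform_within_open[OF that(1) S that(2)] der has_derivative_unique by blast
  have linD: "linear (\<lambda>u. D u v)" for v
  proof (rule linearI)
    show "D (a + b) v = D a v + D b v" for a b
      using D_eqI[OF has_derivative_add[OF der[of a] der[of b]], of "a + b"] lin
      by (simp add: linear_add)
    show "D (c *\<^sub>R a) v = c *\<^sub>R D a v" for c a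
      using D_eqI[OF has_derivative_scaleR_right[OF der[of a]], of c "c *\<^sub>R a"] lin
      by (simp add: linear_scale)
  qed
  then show "linear (\<lambda>u. frechet_derivative (\<lambda>x. L x u) (at x) v)" unfolding D_def .
  \<comment> \<open>Differentiate the expansion in the basis term by term.\<close>
  have "((\<lambda>z. \<Sum>e\<in>Basis. (f z \<bullet> e) *\<^sub>R L z e) has_derivative
      (\<lambda>v. \<Sum>e\<in>Basis. (f x \<bullet> e) *\<^sub>R D e v + (f' v \<bullet> e) *\<^sub>R L x e)) (at x)"
    by (intro has_derivative_sum has_derivative_scaleR has_derivative_inner_left f der)
  moreover have "(\<Sum>e\<in>Basis. (f x \<bullet> e) *\<^sub>R D e v + (f' v \<bullet> e) *\<^sub>R L x e) = D (f x) v + L x (f' v)" for v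
    using euclidean_linear_sum[OF linD, of "f x" v] euclidean_linear_sum[OF lin[OF S(2)], of "f' v"]
    by (simp add: sum.distrib)
  ultimately have "((\<lambda>z. \<Sum>e\<in>Basis. (f z \<bullet> e) *\<^sub>R L z e) has_derivative
      (\<lambda>v. D (f x) v + L x (f' v))) (at x)" by simp
  then have "((\<lambda>z. L z (f z)) has_derivative (\<lambda>v. D (f x) v + L x (f' v))) (at x)"
    by (rule has_derivative_transform_within_open[OF _ S]) (use euclidean_linear_sum[OF lin] in metis)
  then show "((\<lambda>x. L x (f x)) has_derivative
      (\<lambda>v. frechet_derivative (\<lambda>z. L z (f x)) (at x) v + L x (f' v))) (at x)"
    unfolding D_def .
qed

lemma smooth_on_bilinear_family:
  fixes B :: "'a::real_normed_vector \<Rightarrow> 'b::euclidean_space \<Rightarrow> 'c::euclidean_space \<Rightarrow> 'd::real_normed_vector"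
  assumes S: "open S" and bil: "\<And>x. x \<in> S \<Longrightarrow> bilinear (B x)"
    and B: "\<And>u v. smooth_on S (\<lambda>x. B x u v)" and f: "smooth_on S f" and g: "smooth_on S g"
  shows "smooth_on S (\<lambda>x. B x (f x) (g x))"
proof (rule smooth_on_linear_family[OF S _ _ g])
  show "linear (B x (f x))" if "x \<in> S" for x using bil[OF that] by (simp add: bilinear_def)
  show "smooth_on S (\<lambda>x. B x (f x) v)" for v
    using bil by (intro smooth_on_linear_family[where L = "\<lambda>x u. B x u v", OF S _ B f]) (simp add: bilinear_def)
qed

lemma bilinear_family_derivative:
  fixes B :: "'a::real_normed_vector \<Rightarrow> 'b::euclidean_space \<Rightarrow> 'c::euclidean_space \<Rightarrow> 'd::real_normed_vector"
  assumes S: "open S" "x \<in> S" and bil: "\<And>x. x \<in> S \<Longrightarrow> bilinear (B x)"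
    and B: "\<And>u v. (\<lambda>x. B x u v) differentiable (at x)"
    and f: "(f has_derivative f') (at x)" and g: "(g has_derivative g') (at x)"
  shows "bilinear (\<lambda>u w. frechet_derivative (\<lambda>z. B z u w) (at x) v)"
    and "((\<lambda>z. B z (f z) (g z)) has_derivative (\<lambda>v. frechet_derivative (\<lambda>z. B z (f x) (g x)) (at x) v
        + B x (f' v) (g x) + B x (f x) (g' v))) (at x)"
proof -
  have lin1: "linear (\<lambda>u. B z u w)" and lin2: "linear (B z u)" if "z \<in> S" for z u w
    using bil[OF that] by (simp_all add: bilinear_def)
  show "bilinear (\<lambda>u w. frechet_derivative (\<lambda>z. B z u w) (at x) v)"
    unfolding bilinear_def
    using linear_family_derivative(1)[OF S lin2 B has_derivative_const]
      linear_family_derivative(1)[OF S lin1 B has_derivative_const] by blast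
  have d1: "((\<lambda>z. B z (f z) w) has_derivative
      (\<lambda>v. frechet_derivative (\<lambda>z. B z (f x) w) (at x) v + B x (f' v) w)) (at x)" for w
    by (rule linear_family_derivative(2)[OF S lin1 B f])
  then have diff: "(\<lambda>z. B z (f z) w) differentiable (at x)" for w
    unfolding differentiable_def by blast
  have "frechet_derivative (\<lambda>z. B z (f z) (g x)) (at x) =
      (\<lambda>v. frechet_derivative (\<lambda>z. B z (f x) (g x)) (at x) v + B x (f' v) (g x))"
    by (rule frechet_derivative_at[OF d1, symmetric])
  then show "((\<lambda>z. B z (f z) (g z)) has_derivative (\<lambda>v. frechet_derivative (\<lambda>z. B z (f x) (g x)) (at x) v
        + B x (f' v) (g x) + B x (f x) (g' v))) (at x)"
    using linear_family_derivative(2)[OF S lin2 diff g] by simp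
qed

section \<open>Symmetry of second derivatives\<close>

text \<open>The mean value theorem in the direction \<open>u\<close>, applied to \<open>\<tau> \<mapsto> f (x + \<tau>u + sv) - f (x + \<tau>u)\<close>, and then in the
  direction \<open>v\<close>. The left-hand side is symmetric in \<open>u\<close> and \<open>v\<close>, which is what makes the second
  derivatives agree.\<close>

lemma second_difference_mean_value:
  fixes f :: "'a::real_normed_vector \<Rightarrow> real"
  assumes S: "open S" and f: "smooth_on S f"
    and box: "\<And>a b. 0 \<le> a \<Longrightarrow> a \<le> s \<Longrightarrow> 0 \<le> b \<Longrightarrow> b \<le> s \<Longrightarrow> x + a *\<^sub>R u + b *\<^sub>R v \<in> S" and s: "0 < s"
  shows "\<exists>a\<in>{0..s}. \<exists>b\<in>{0..s}. f (x + s *\<^sub>R u + s *\<^sub>R v) - f (x + s *\<^sub>R u) - f (x + s *\<^sub>R v) + f x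
    = s * s * frechet_derivative (\<lambda>z. frechet_derivative f (at z) u) (at (x + a *\<^sub>R u + b *\<^sub>R v)) v"
proof -
  define D where "D z = frechet_derivative f (at z)" for z
  have line: "((\<lambda>t. F (p + t *\<^sub>R w)) has_derivative (\<lambda>h. h * frechet_derivative F (at (p + t *\<^sub>R w)) w)) (at t within T)"
    if F: "smooth_on S F" and p: "p + t *\<^sub>R w \<in> S" for F p t w T
  proof -
    have "((\<lambda>t. F (p + t *\<^sub>R w)) has_derivative (\<lambda>h. frechet_derivative F (at (p + t *\<^sub>R w)) (h *\<^sub>R w))) (at t within T)"
      by (rule has_derivative_compose[where f = "\<lambda>t. p + t *\<^sub>R w", OF _ smooth_on_has_derivative[OF F p]])
         (auto intro!: derivative_eq_intros)
    moreover have "linear (frechet_derivative F (at (p + t *\<^sub>R w)))"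
      using F p by (intro linear_frechet_derivative smooth_on_differentiable)
    ultimately show ?thesis by (simp add: linear_scale)
  qed
  have "\<exists>a\<in>{0..s}. (f ((x + s *\<^sub>R v) + s *\<^sub>R u) - f (x + s *\<^sub>R u)) - (f ((x + s *\<^sub>R v) + 0 *\<^sub>R u) - f (x + 0 *\<^sub>R u))
     = (s - 0) * D ((x + s *\<^sub>R v) + a *\<^sub>R u) u - (s - 0) * D (x + a *\<^sub>R u) u"
    unfolding D_def
    using box[of _ s] box[of _ 0] s
    by (intro mvt_very_simple has_derivative_diff line f) (auto simp: algebra_simps)
  then obtain a where a: "a \<in> {0..s}"
    "f (x + s *\<^sub>R u + s *\<^sub>R v) - f (x + s *\<^sub>R u) - f (x + s *\<^sub>R v) + f x
     = s * (D ((x + a *\<^sub>R u) + s *\<^sub>R v) u - D ((x + a *\<^sub>R u) + 0 *\<^sub>R v) u)"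
    by (auto simp: algebra_simps)
  have "\<exists>b\<in>{0..s}. D ((x + a *\<^sub>R u) + s *\<^sub>R v) u - D ((x + a *\<^sub>R u) + 0 *\<^sub>R v) u
      = (s - 0) * frechet_derivative (\<lambda>z. D z u) (at ((x + a *\<^sub>R u) + b *\<^sub>R v)) v"
    unfolding D_def
    using box[of a] a(1) s
    by (intro mvt_very_simple line smooth_on_frechet f) auto
  then show ?thesis using a unfolding D_def by (auto simp: mult.assoc)
qed

text \<open>The second difference over a small parallelogram equals \<open>s\<^sup>2\<close> times either mixed derivative, each at
  some nearby point; by continuity the two mixed derivatives agree at \<open>x\<close>.\<close>

lemma symmetric_second_derivative_real:
  fixes f :: "'a::real_normed_vector \<Rightarrow> real"
  assumes S: "open S" "x \<in> S" and f: "smooth_on S f"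
  shows "frechet_derivative (\<lambda>z. frechet_derivative f (at z) u) (at x) v
    = frechet_derivative (\<lambda>z. frechet_derivative f (at z) v) (at x) u"
proof -
  define D where "D u v z = frechet_derivative (\<lambda>z. frechet_derivative f (at z) u) (at z) v" for u v z
  have cont: "isCont (D u v) x" for u v
    unfolding D_def using S f
    by (metis continuous_on_eq_continuous_at smooth_on_continuous smooth_on_frechet)
  have "\<bar>D u v x - D v u x\<bar> \<le> 0 + e" if "e > 0" for e
  proof -
    obtain d1 where d1: "d1 > 0" "\<And>z. dist z x < d1 \<Longrightarrow> dist (D u v z) (D u v x) < e / 2"
      using cont[of u v] \<open>e > 0\<close> unfolding continuous_at_eps_delta by (metis half_gt_zero)
    obtain d2 where d2: "d2 > 0" "\<And>z. dist z x < d2 \<Longrightarrow> dist (D v u z) (D v u x) < e / 2"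
      using cont[of v u] \<open>e > 0\<close> unfolding continuous_at_eps_delta by (metis half_gt_zero)
    obtain d3 where d3: "d3 > 0" "ball x d3 \<subseteq> S" using S open_contains_ball by blast
    define d where "d = min d1 (min d2 d3)"
    \<comment> \<open>This side length keeps the parallelogram within distance \<open>d\<close> of \<open>x\<close>, also if \<open>u = v = 0\<close>.\<close>
    define s where "s = d / (2 * (norm u + norm v + 1))"
    have "d > 0" using d1 d2 d3 by (simp add: d_def)
    have nn: "norm u + norm v + 1 > 0" by (simp add: add_nonneg_pos)
    then have s: "s > 0" using \<open>d > 0\<close> by (simp add: s_def)
    have near: "dist (x + a *\<^sub>R u + b *\<^sub>R v) x < d" if "0 \<le> a" "a \<le> s" "0 \<le> b" "b \<le> s" for a b
    proof -
      have "dist (x + a *\<^sub>R u + b *\<^sub>R v) x \<le> a * norm u + b * norm v"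
        using norm_triangle_ineq[of "a *\<^sub>R u" "b *\<^sub>R v"] that by (simp add: dist_norm add.assoc)
      also have "\<dots> \<le> s * norm u + s * norm v" using that by (intro add_mono mult_right_mono) auto
      also have "\<dots> < s * (2 * (norm u + norm v + 1))"
        using s nn by (simp add: algebra_simps add_nonneg_pos add_pos_nonneg add_strict_increasing2)
      also have "\<dots> = d" using nn by (simp add: s_def)
      finally show ?thesis .
    qed
    have inS: "x + a *\<^sub>R u + b *\<^sub>R v \<in> S" if "0 \<le> a" "a \<le> s" "0 \<le> b" "b \<le> s" for a b
      using near[OF that] d3(2) by (auto simp: d_def dist_commute subset_iff)
    obtain a b where ab: "a \<in> {0..s}" "b \<in> {0..s}"
      "f (x + s *\<^sub>R u + s *\<^sub>R v) - f (x + s *\<^sub>R u) - f (x + s *\<^sub>R v) + f x = s * s * D u v (x + a *\<^sub>R u + b *\<^sub>R v)"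
      using second_difference_mean_value[OF S(1) f inS s] unfolding D_def by blast
    have inS': "x + a *\<^sub>R v + b *\<^sub>R u \<in> S" if "0 \<le> a" "a \<le> s" "0 \<le> b" "b \<le> s" for a b
      using inS[OF that(3,4,1,2)] by (simp add: algebra_simps)
    obtain a' b' where ab': "a' \<in> {0..s}" "b' \<in> {0..s}"
      "f (x + s *\<^sub>R v + s *\<^sub>R u) - f (x + s *\<^sub>R v) - f (x + s *\<^sub>R u) + f x = s * s * D v u (x + a' *\<^sub>R v + b' *\<^sub>R u)"
      using second_difference_mean_value[OF S(1) f inS' s] unfolding D_def by blast
    have "x + s *\<^sub>R v + s *\<^sub>R u = x + s *\<^sub>R u + s *\<^sub>R v" by (simp add: algebra_simps)
    then have "f (x + s *\<^sub>R v + s *\<^sub>R u) = f (x + s *\<^sub>R u + s *\<^sub>R v)" by (rule arg_cong)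
    with ab(3) ab'(3) have "s * s * D u v (x + a *\<^sub>R u + b *\<^sub>R v) = s * s * D v u (x + a' *\<^sub>R v + b' *\<^sub>R u)"
      by linarith
    then have "D u v (x + a *\<^sub>R u + b *\<^sub>R v) = D v u (x + a' *\<^sub>R v + b' *\<^sub>R u)" using s by simp
    moreover have "dist (D u v (x + a *\<^sub>R u + b *\<^sub>R v)) (D u v x) < e / 2"
      using near[of a b] ab by (intro d1(2)) (simp add: d_def)
    moreover have "dist (D v u (x + a' *\<^sub>R v + b' *\<^sub>R u)) (D v u x) < e / 2"
      using near[of b' a'] ab' by (intro d2(2)) (simp add: d_def algebra_simps)
    ultimately show ?thesis unfolding dist_real_def by arith
  qed
  then have "\<bar>D u v x - D v u x\<bar> \<le> 0" by (rule field_le_epsilon)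
  then show ?thesis by (simp add: D_def)
qed

lemma symmetric_second_derivative:
  fixes f :: "'a::real_normed_vector \<Rightarrow> 'b::real_inner"
  assumes S: "open S" "x \<in> S" and f: "smooth_on S f"
  shows "frechet_derivative (\<lambda>z. frechet_derivative f (at z) u) (at x) v
    = frechet_derivative (\<lambda>z. frechet_derivative f (at z) v) (at x) u"
proof -
  have comp: "frechet_derivative (\<lambda>z. F z \<bullet> b) (at z) w = frechet_derivative F (at z) w \<bullet> b"
    if "smooth_on S F" "z \<in> S" for F :: "'a \<Rightarrow> 'b" and z w b
    using frechet_derivative_at[OF has_derivative_inner_left[OF smooth_on_has_derivative[OF that], of b]]
    by metis
  have fb: "smooth_on S (\<lambda>z. f z \<bullet> b)" for b by (rule smooth_on_inner[OF S(1) f smooth_on_const])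
  have eq: "frechet_derivative (\<lambda>z. frechet_derivative (\<lambda>z. f z \<bullet> b) (at z) u) (at x) v =
    frechet_derivative (\<lambda>z. frechet_derivative f (at z) u) (at x) v \<bullet> b" for u v b
    using frechet_derivative_transform_within_open[OF smooth_on_differentiable[OF smooth_on_frechet[OF fb] S(2)] S comp[OF f]]
      comp[OF smooth_on_frechet[OF f] S(2)] by metis
  show ?thesis
    by (rule vector_eq_rdot[THEN iffD1])
       (use symmetric_second_derivative_real[OF S fb, of _ u v] in \<open>simp add: eq\<close>)
qed

section \<open>Linear systems with smooth coefficients\<close>

text \<open>A product of two functions that vanish at \<open>x\<close>, one continuous and one differentiable there, is of second
  order. It controls the error term \<open>(L z - L x) (w z - w x)\<close> below.\<close>

lemma has_derivative_scaleR_vanishing: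
  fixes k :: "'a::real_normed_vector \<Rightarrow> real" and q :: "'a \<Rightarrow> 'b::real_normed_vector"
  assumes k: "(k \<longlongrightarrow> 0) (at x)" and q: "(q has_derivative q') (at x)" and q0: "q x = 0"
  shows "((\<lambda>z. k z *\<^sub>R q z) has_derivative (\<lambda>v. 0)) (at x)"
proof -
  obtain K where K: "\<And>v. norm (q' v) \<le> norm v * K"
    using has_derivative_bounded_linear[OF q] bounded_linear.nonneg_bounded by blast
  have err: "((\<lambda>y. norm (q y - q x - q' (y - x)) / norm (y - x)) \<longlongrightarrow> 0) (at x)"
    using q by (simp add: has_derivative_iff_norm)
  have "((\<lambda>y. norm (k y *\<^sub>R q y) / norm (y - x)) \<longlongrightarrow> 0) (at x)"
  proof (rule Lim_null_comparison)
    show "\<forall>\<^sub>F y in at x. norm (norm (k y *\<^sub>R q y) / norm (y - x)) \<le>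
        \<bar>k y\<bar> * (norm (q y - q x - q' (y - x)) / norm (y - x) + K)"
      unfolding eventually_at_filter
    proof (intro always_eventually allI impI)
      fix y assume "y \<noteq> x"
      then have n: "norm (y - x) > 0" by simp
      have "norm (q y) \<le> norm (q y - q x - q' (y - x)) + norm (y - x) * K"
        using norm_triangle_ineq[of "q y - q' (y - x)" "q' (y - x)"] K[of "y - x"] q0 by simp
      then have "norm (q y) / norm (y - x) \<le> norm (q y - q x - q' (y - x)) / norm (y - x) + K"
        using n by (simp add: field_simps)
      then show "norm (norm (k y *\<^sub>R q y) / norm (y - x)) \<le>
        \<bar>k y\<bar> * (norm (q y - q x - q' (y - x)) / norm (y - x) + K)"
        using mult_left_mono[OF _ abs_ge_zero[of "k y"]] by fastforce
    qed
    have "((\<lambda>y. \<bar>k y\<bar> * (norm (q y - q x - q' (y - x)) / norm (y - x) + K)) \<longlongrightarrow> 0 * (0 + K)) (at x)"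
      by (intro tendsto_mult tendsto_add err tendsto_const tendsto_rabs_zero k)
    then show "((\<lambda>y. \<bar>k y\<bar> * (norm (q y - q x - q' (y - x)) / norm (y - x) + K)) \<longlongrightarrow> 0) (at x)" by simp
  qed
  then show ?thesis by (simp add: has_derivative_iff_norm q0)
qed

text \<open>The injective map \<open>L x\<close> is bounded below, hence, with half the constant, so is every \<open>L z\<close> with \<open>z\<close> close to
  \<open>x\<close>. Since \<open>L z (w z - w x) = h z - L z (w x)\<close> tends to \<open>0\<close>, so does \<open>w z - w x\<close>.\<close>

lemma continuous_solution_linear_family:
  fixes L :: "'a::real_normed_vector \<Rightarrow> 'b::euclidean_space \<Rightarrow> 'b"
  assumes S: "open S" "x \<in> S" and lin: "\<And>x. x \<in> S \<Longrightarrow> linear (L x)" and inj: "inj (L x)"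
    and L: "\<And>u. isCont (\<lambda>x. L x u) x" and h: "isCont h x"
    and w: "\<And>x. x \<in> S \<Longrightarrow> L x (w x) = h x"
  shows "(w \<longlongrightarrow> w x) (at x)"
proof -
  obtain c where c: "c > 0" "\<And>u. c * norm u \<le> norm (L x u)"
    using linear_inj_bounded_below_pos[OF lin[OF S(2)] inj] by blast
  define d where "d z = (\<Sum>e\<in>Basis. norm (L z e - L x e))" for z
  have "(d \<longlongrightarrow> (\<Sum>e\<in>Basis. norm (L x e - L x e))) (at x)"
    unfolding d_def using L by (intro tendsto_intros) (simp add: isCont_def)
  then have "\<forall>\<^sub>F z in at x. d z < c / 2" using c(1) by (intro order_tendstoD) auto
  moreover have "\<forall>\<^sub>F z in at x. z \<in> S" using S eventually_at_topological by blast
  ultimately have "\<forall>\<^sub>F z in at x. norm (w z - w x) \<le> norm (h z - L z (w x)) * (2 / c)"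
  proof eventually_elim
    case (elim z)
    define u where "u = w z - w x"
    have Lz: "linear (L z)" using lin elim by blast
    have linz: "linear (\<lambda>u. L z u - L x u)" using lin elim S by (intro linear_compose_sub) auto
    have "norm (L z u - L x u) = norm (\<Sum>e\<in>Basis. (u \<bullet> e) *\<^sub>R (L z e - L x e))"
      using euclidean_linear_sum[OF linz, of u] by simp
    also have "\<dots> \<le> (\<Sum>e\<in>Basis. norm u * norm (L z e - L x e))"
      by (rule sum_norm_le) (auto intro!: mult_right_mono Basis_le_norm)
    also have "\<dots> = norm u * d z" by (simp add: d_def sum_distrib_left)
    also have "\<dots> \<le> norm u * (c / 2)" using elim by (intro mult_left_mono) auto
    finally have "norm (L z u - L x u) \<le> norm u * (c / 2)" .
    then have "c / 2 * norm u \<le> norm (L z u)"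
      using c(2)[of u] norm_triangle_ineq3[of "L z u" "L x u"] by (simp add: field_simps)
    moreover have "L z u = h z - L z (w x)" using w elim linear_diff[OF Lz] by (simp add: u_def)
    ultimately have "c / 2 * norm u \<le> norm (h z - L z (w x))" by simp
    then show ?case using c(1) by (simp add: u_def field_simps)
  qed
  moreover have "((\<lambda>z. norm (h z - L z (w x)) * (2 / c)) \<longlongrightarrow> norm (h x - L x (w x)) * (2 / c)) (at x)"
    using L[of "w x"] h by (intro tendsto_intros) (auto simp: isCont_def)
  ultimately have "((\<lambda>z. w z - w x) \<longlongrightarrow> 0) (at x)"
    using w[OF S(2)] Lim_null_comparison by fastforce
  then show ?thesis using LIM_zero_iff by blast
qed

text \<open>Solving \<open>L z (w z) = h z\<close> for \<open>w z\<close> with the fixed inverse of \<open>L x\<close> gives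
  \<open>w z = w x + (L x)\<^sup>-\<^sup>1 (h z - L z (w x) - (L z - L x) (w z - w x))\<close>. The last term is of second order, so
  the other terms give the derivative.\<close>

lemma has_derivative_solution_linear_family:
  fixes L :: "'a::real_normed_vector \<Rightarrow> 'b::euclidean_space \<Rightarrow> 'b"
  assumes S: "open S" "x \<in> S" and lin: "\<And>x. x \<in> S \<Longrightarrow> linear (L x)" and inj: "inj (L x)"
    and L: "\<And>u. (\<lambda>x. L x u) differentiable (at x)" and h: "(h has_derivative h') (at x)"
    and w: "\<And>x. x \<in> S \<Longrightarrow> L x (w x) = h x"
  shows "(w has_derivative (\<lambda>v. inv (L x) (h' v - frechet_derivative (\<lambda>z. L z (w x)) (at x) v))) (at x)"
proof -
  define P where "P = inv (L x)"
  have PL: "P (L x u) = u" for u unfolding P_def using inj by simp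
  have "linear P"
    unfolding P_def using lin[OF S(2)] inj by (rule inj_linear_imp_inv_linear)
  then have bP: "bounded_linear P" by (rule linear_conv_bounded_linear[THEN iffD1])
  have Ld: "((\<lambda>z. L z u) has_derivative frechet_derivative (\<lambda>z. L z u) (at x)) (at x)" for u
    using L frechet_derivative_works by blast
  have lim: "(w \<longlongrightarrow> w x) (at x)"
    using L differentiable_imp_continuous_within has_derivative_continuous[OF h]
    by (intro continuous_solution_linear_family[where h = h, OF S lin inj _ _ w]) auto
  have term_deriv: "((\<lambda>z. ((w z - w x) \<bullet> e) *\<^sub>R (L z e - L x e)) has_derivative (\<lambda>v. 0)) (at x)" for e
  proof (rule has_derivative_scaleR_vanishing)
    show "((\<lambda>z. (w z - w x) \<bullet> e) \<longlongrightarrow> 0) (at x)"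
      using tendsto_inner[OF tendsto_diff[OF lim tendsto_const[of "w x"]] tendsto_const[of e]] by simp
    show "((\<lambda>z. L z e - L x e) has_derivative (\<lambda>v. frechet_derivative (\<lambda>z. L z e) (at x) v - 0)) (at x)"
      by (intro has_derivative_diff Ld has_derivative_const)
  qed simp
  have "((\<lambda>z. w x + P (h z - L z (w x) - (\<Sum>e\<in>Basis. ((w z - w x) \<bullet> e) *\<^sub>R (L z e - L x e)))) has_derivative
     (\<lambda>v. 0 + P (h' v - frechet_derivative (\<lambda>z. L z (w x)) (at x) v - (\<Sum>e\<in>(Basis::'b set). 0)))) (at x)"
    by (intro has_derivative_add has_derivative_const bounded_linear.has_derivative[OF bP]
        has_derivative_diff h Ld has_derivative_sum term_deriv)
  then have "((\<lambda>z. w x + P (h z - L z (w x) - (\<Sum>e\<in>Basis. ((w z - w x) \<bullet> e) *\<^sub>R (L z e - L x e)))) has_derivative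
     (\<lambda>v. P (h' v - frechet_derivative (\<lambda>z. L z (w x)) (at x) v))) (at x)" by simp
  then show ?thesis
    unfolding P_def[symmetric]
  proof (rule has_derivative_transform_within_open[OF _ S])
    fix z assume z: "z \<in> S"
    have "linear (\<lambda>u. L z u - L x u)" using lin z S by (intro linear_compose_sub) auto
    from euclidean_linear_sum[OF this, of "w z - w x"]
    have "(\<Sum>e\<in>Basis. ((w z - w x) \<bullet> e) *\<^sub>R (L z e - L x e)) = h z - L z (w x) - L x (w z - w x)"
      using w[OF z] linear_diff[OF lin[OF z]] by simp
    then show "w x + P (h z - L z (w x) - (\<Sum>e\<in>Basis. ((w z - w x) \<bullet> e) *\<^sub>R (L z e - L x e))) = w z"
      by (simp add: PL)
  qed
qed

text \<open>Bootstrapping: the derivative \<open>w'\<close> of the solution solves a system with the same coefficients and the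
  right-hand side \<open>h' - L' w\<close>, which has as many continuous derivatives as \<open>w\<close> is already known to have.
  Therefore the induction runs over the order for all right-hand sides.\<close>

lemma smooth_on_solution_linear_family:
  fixes L :: "'a::real_normed_vector \<Rightarrow> 'b::euclidean_space \<Rightarrow> 'b"
  assumes S: "open S" and lin: "\<And>x. x \<in> S \<Longrightarrow> linear (L x)" and inj: "\<And>x. x \<in> S \<Longrightarrow> inj (L x)"
    and L: "\<And>u. smooth_on S (\<lambda>x. L x u)" and h: "smooth_on S h"
    and w: "\<And>x. x \<in> S \<Longrightarrow> L x (w x) = h x"
  shows "smooth_on S w"
proof -
  have "Ck_on k S w" if "Ck_on k S h" "\<And>x. x \<in> S \<Longrightarrow> L x (w x) = h x" for k h w
    using that
  proof (induction k arbitrary: h w)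
    case 0
    have "isCont w x" if x: "x \<in> S" for x
      unfolding isCont_def
    proof (rule continuous_solution_linear_family[where h = h, OF S x lin inj[OF x] _ _ 0(2)])
      show "isCont (\<lambda>x. L x u) x" for u
        using smooth_on_continuous[OF L] S x continuous_on_eq_continuous_at by blast
      show "isCont h x" using 0(1) S x continuous_on_eq_continuous_at by fastforce
    qed
    then show ?case by (simp add: continuous_at_imp_continuous_on)
  next
    case (Suc k)
    define D where "D x u v = frechet_derivative (\<lambda>z. L z u) (at x) v" for x u v
    define w' where "w' x = (\<lambda>v. inv (L x) (frechet_derivative h (at x) v - D x (w x) v))" for x
    have linD: "linear (\<lambda>u. D x u v)" if x: "x \<in> S" for x v
      unfolding D_def
      by (rule linear_family_derivative(1)[OF S x lin smooth_on_differentiable[OF L x] has_derivative_const])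
    show ?case
    proof (rule Ck_on_SucI[OF S])
      fix x assume x: "x \<in> S"
      have "(h has_derivative frechet_derivative h (at x)) (at x)"
        using Ck_on_differentiable[OF Suc.prems(1) x] frechet_derivative_works by blast
      from has_derivative_solution_linear_family[OF S x lin inj[OF x] smooth_on_differentiable[OF L x] this Suc.prems(2)]
      show "(w has_derivative w' x) (at x)" unfolding w'_def D_def .
    next
      fix v
      have "Ck_on k S w" using Suc.IH[OF Ck_on_pred] Suc.prems by blast
      then have "Ck_on k S (\<lambda>x. \<Sum>e\<in>Basis. (w x \<bullet> e) *\<^sub>R D x e v)"
        unfolding D_def
        by (intro Ck_on_sum[OF S] Ck_on_bounded_bilinear[OF S bounded_bilinear_scaleR]
            Ck_on_bounded_linear_comp[OF S bounded_linear_inner_left] smooth_on_Ck[OF smooth_on_frechet[OF L]])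
      then have "Ck_on k S (\<lambda>x. D x (w x) v)"
        by (subst Ck_on_cong[OF S euclidean_linear_sum[OF linD]]) auto
      then have "Ck_on k S (\<lambda>x. - D x (w x) v)"
        by (rule Ck_on_bounded_linear_comp[OF S bounded_linear_minus[OF bounded_linear_ident]])
      then have "Ck_on k S (\<lambda>x. frechet_derivative h (at x) v + - D x (w x) v)"
        using Suc.prems(1) by (intro Ck_on_add[OF S]) simp
      then show "Ck_on k S (\<lambda>x. w' x v)"
      proof (rule Suc.IH)
        fix x assume x: "x \<in> S"
        then have "surj (L x)" using linear_injective_imp_surjective[OF lin inj] by blast
        then show "L x (w' x v) = frechet_derivative h (at x) v + - D x (w x) v"
          unfolding w'_def by (simp add: surj_f_inv_f)
      qed
    qed
  qed
  then show ?thesis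
    using smooth_on_Ck[OF h] w unfolding smooth_on_def by blast
qed

section \<open>Charts and Jacobians\<close>

locale manifold =
  fixes M :: "('a, 'i, 'e::euclidean_space) atlas"
  assumes smooth_manifold: "smooth_manifold M"
begin

lemma cdom_open: "i \<in> idx M \<Longrightarrow> openin (mtop M) (cdom M i)"
  and cimg_open: "i \<in> idx M \<Longrightarrow> open (cimg M i)"
  and chart_homeo: "i \<in> idx M \<Longrightarrow>
    homeomorphic_map (subtopology (mtop M) (cdom M i)) (top_of_set (cimg M i)) (chart M i)"
  and transition_smooth: "i \<in> idx M \<Longrightarrow> j \<in> idx M \<Longrightarrow> smooth_on (overlap M i j) (transition M i j)"
  and cdom_cover: "(\<Union>i\<in>idx M. cdom M i) = topspace (mtop M)"
  using smooth_manifold by (auto simp: smooth_manifold_def)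

lemma chart_topspace: "i \<in> idx M \<Longrightarrow> topspace (subtopology (mtop M) (cdom M i)) = cdom M i"
  using openin_subset[OF cdom_open] by auto

lemma chart_inj: "i \<in> idx M \<Longrightarrow> inj_on (chart M i) (cdom M i)"
  using homeomorphic_imp_injective_map[OF chart_homeo] chart_topspace by simp

lemma chart_image_open:
  assumes "i \<in> idx M" "openin (mtop M) U" "U \<subseteq> cdom M i"
  shows "open (chart M i ` U)"
proof -
  have "openin (subtopology (mtop M) (cdom M i)) U"
    using assms cdom_open openin_open_subtopology by blast
  then have "openin (top_of_set (cimg M i)) (chart M i ` U)"
    using homeomorphic_map_openness[OF chart_homeo[OF assms(1)]] assms chart_topspace by blast
  then show ?thesis using cimg_open[OF assms(1)] openin_open_eq by blast
qed

lemma chart_inverse: "i \<in> idx M \<Longrightarrow> p \<in> cdom M i \<Longrightarrow> inv_into (cdom M i) (chart M i) (chart M i p) = p"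
  using chart_inj inv_into_f_f by metis

lemma transition_chart: "i \<in> idx M \<Longrightarrow> p \<in> cdom M i \<Longrightarrow> transition M i j (chart M i p) = chart M j p"
  by (simp add: transition_def chart_inverse)

lemma overlap_open: "i \<in> idx M \<Longrightarrow> j \<in> idx M \<Longrightarrow> open (overlap M i j)"
  unfolding overlap_def by (intro chart_image_open openin_Int cdom_open) auto

lemma chart_in_overlap: "p \<in> cdom M i \<Longrightarrow> p \<in> cdom M j \<Longrightarrow> chart M i p \<in> overlap M i j"
  by (auto simp: overlap_def)

lemma overlap_subset: "overlap M i j \<subseteq> cimg M i"
  by (auto simp: overlap_def cimg_def)

lemma transition_in_overlap:
  "i \<in> idx M \<Longrightarrow> x \<in> overlap M i j \<Longrightarrow> transition M i j x \<in> overlap M j i"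
  by (auto simp: overlap_def transition_chart)

lemma transition_has_derivative:
  "i \<in> idx M \<Longrightarrow> j \<in> idx M \<Longrightarrow> x \<in> overlap M i j \<Longrightarrow>
    (transition M i j has_derivative jacobian M i j x) (at x)"
  unfolding jacobian_def using smooth_on_has_derivative[OF transition_smooth] .

lemma jacobian_linear: "i \<in> idx M \<Longrightarrow> j \<in> idx M \<Longrightarrow> x \<in> overlap M i j \<Longrightarrow> linear (jacobian M i j x)"
  using transition_has_derivative has_derivative_linear by blast

lemma jacobian_smooth:
  "i \<in> idx M \<Longrightarrow> j \<in> idx M \<Longrightarrow> smooth_on (overlap M i j) (\<lambda>x. jacobian M i j x u)"
  unfolding jacobian_def by (intro smooth_on_frechet transition_smooth)

lemma jacobian_cocycle:
  assumes ijk: "i \<in> idx M" "j \<in> idx M" "k \<in> idx M"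
    and p: "p \<in> cdom M i" "p \<in> cdom M j" "p \<in> cdom M k"
  shows "jacobian M j k (chart M j p) (jacobian M i j (chart M i p) u) = jacobian M i k (chart M i p) u"
proof -
  define U where "U = chart M i ` (cdom M i \<inter> cdom M j \<inter> cdom M k)"
  have U: "open U" "chart M i p \<in> U"
    unfolding U_def using ijk p by (auto intro!: chart_image_open openin_Int cdom_open)
  have "((\<lambda>x. transition M j k (transition M i j x)) has_derivative
      (\<lambda>u. jacobian M j k (transition M i j (chart M i p)) (jacobian M i j (chart M i p) u))) (at (chart M i p))"
  proof (rule has_derivative_compose[where f = "transition M i j" and g = "transition M j k"
        and f' = "jacobian M i j (chart M i p)"])
    show "(transition M i j has_derivative jacobian M i j (chart M i p)) (at (chart M i p))"
      using ijk p by (intro transition_has_derivative chart_in_overlap)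
    show "(transition M j k has_derivative jacobian M j k (transition M i j (chart M i p)))
        (at (transition M i j (chart M i p)))"
      unfolding transition_chart[OF ijk(1) p(1)]
      using ijk p by (intro transition_has_derivative chart_in_overlap)
  qed
  then have "(transition M i k has_derivative
      (\<lambda>u. jacobian M j k (transition M i j (chart M i p)) (jacobian M i j (chart M i p) u))) (at (chart M i p))"
    by (rule has_derivative_transform_within_open[OF _ U])
       (auto simp: U_def transition_chart ijk)
  moreover have "(transition M i k has_derivative jacobian M i k (chart M i p)) (at (chart M i p))"
    using ijk p by (intro transition_has_derivative chart_in_overlap)
  ultimately have "jacobian M i k (chart M i p) =
      (\<lambda>u. jacobian M j k (transition M i j (chart M i p)) (jacobian M i j (chart M i p) u))"
    using has_derivative_unique by blast
  then show ?thesis using ijk p by (simp add: transition_chart)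
qed

lemma jacobian_self: "i \<in> idx M \<Longrightarrow> p \<in> cdom M i \<Longrightarrow> jacobian M i i (chart M i p) u = u"
proof -
  assume i: "i \<in> idx M" and p: "p \<in> cdom M i"
  have "(transition M i i has_derivative (\<lambda>u. u)) (at (chart M i p))"
    by (rule has_derivative_transform_within_open[OF has_derivative_ident cimg_open[OF i]])
       (use i p in \<open>auto simp: cimg_def transition_chart\<close>)
  moreover have "(transition M i i has_derivative jacobian M i i (chart M i p)) (at (chart M i p))"
    using i p by (intro transition_has_derivative chart_in_overlap)
  ultimately show ?thesis using has_derivative_unique by metis
qed

lemma jacobian_inverse:
  assumes "i \<in> idx M" "j \<in> idx M" "x \<in> overlap M i j"
  shows "jacobian M j i (transition M i j x) (jacobian M i j x u) = u"
    and "jacobian M i j x (jacobian M j i (transition M i j x) u) = u"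
proof -
  obtain p where p: "p \<in> cdom M i" "p \<in> cdom M j" "x = chart M i p"
    using assms(3) by (auto simp: overlap_def)
  show "jacobian M j i (transition M i j x) (jacobian M i j x u) = u"
    using p assms jacobian_cocycle[of i j i p u] by (simp add: transition_chart jacobian_self)
  show "jacobian M i j x (jacobian M j i (transition M i j x) u) = u"
    using p assms jacobian_cocycle[of j i j p u] by (simp add: transition_chart jacobian_self)
qed

section \<open>The tangent bundle as a smooth manifold\<close>

abbreviation "TM \<equiv> tangent_bundle M"

lemma TM_simps [simp]: "idx TM = idx M" "cdom TM = tb_cdom M" "chart TM = tb_chart M"
  by (simp_all add: tangent_bundle_def)

lemma tb_chart_simp [simp]: "tb_chart M i (p, v) = (chart M i p, v i)"
  by (simp add: tb_chart_def)

lemma tb_cdom_iff: "w \<in> tb_cdom M i \<longleftrightarrow> w \<in> tangent_vectors M \<and> fst w \<in> cdom M i"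
  by (auto simp: tb_cdom_def)

lemma tb_cdom_transform:
  "i \<in> idx M \<Longrightarrow> j \<in> idx M \<Longrightarrow> (p, v) \<in> tb_cdom M i \<Longrightarrow> p \<in> cdom M j \<Longrightarrow>
    v j = jacobian M i j (chart M i p) (v i)"
  unfolding tb_cdom_def tangent_vectors_def by blast

lemma tb_chart_inj: 
  assumes i: "i \<in> idx M" shows "inj_on (tb_chart M i) (tb_cdom M i)"
proof (rule inj_onI, clarsimp)
  fix p v q w
  assume pv: "(p, v) \<in> tb_cdom M i" and qw: "(q, w) \<in> tb_cdom M i"
    and c: "chart M i p = chart M i q" and vw: "v i = w i"
  have pq: "p = q"
    using pv qw c inj_onD[OF chart_inj[OF i]] by (simp add: tb_cdom_iff)
  have "v j = w j" for j
  proof (cases "j \<in> idx M \<and> p \<in> cdom M j")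
    case True
    then show ?thesis using tb_cdom_transform[OF i _ pv] tb_cdom_transform[OF i _ qw] pq vw by simp
  next
    case False
    then have "v j = 0" "w j = 0" using pv qw pq unfolding tb_cdom_def tangent_vectors_def by blast+
    then show ?thesis by simp
  qed
  then show "p = q \<and> v = w" using pq by blast
qed

text \<open>Every fibre coordinate occurs: transport \<open>y\<close> to the other charts by the Jacobians. The cocycle identity
  makes the resulting family a tangent vector.\<close>

lemma tangent_vector_exists:
  assumes i: "i \<in> idx M" and p: "p \<in> cdom M i"
  shows "\<exists>v. (p, v) \<in> tb_cdom M i \<and> v i = y"
proof -
  define v where "v j = (if j \<in> idx M \<and> p \<in> cdom M j then jacobian M i j (chart M i p) y else 0)" for j
  have "p \<in> topspace (mtop M)" using cdom_cover i p by blast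
  then have "(p, v) \<in> tb_cdom M i"
    using p i by (auto simp: tb_cdom_def tangent_vectors_def v_def jacobian_cocycle)
  then show ?thesis using i p jacobian_self by (auto simp: v_def)
qed

lemma tb_chart_image: "i \<in> idx M \<Longrightarrow> V \<subseteq> cdom M i \<Longrightarrow>
    tb_chart M i ` {w \<in> tb_cdom M i. fst w \<in> V} = (chart M i ` V) \<times> UNIV"
proof
  assume i: "i \<in> idx M" and V: "V \<subseteq> cdom M i"
  show "tb_chart M i ` {w \<in> tb_cdom M i. fst w \<in> V} \<subseteq> (chart M i ` V) \<times> UNIV" by auto
  show "(chart M i ` V) \<times> UNIV \<subseteq> tb_chart M i ` {w \<in> tb_cdom M i. fst w \<in> V}"
  proof clarify
    fix p y assume p: "p \<in> V"
    then obtain v where "(p, v) \<in> tb_cdom M i" "v i = y" using tangent_vector_exists i V by blast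
    then show "(chart M i p, y) \<in> tb_chart M i ` {w \<in> tb_cdom M i. fst w \<in> V}"
      using p by (intro image_eqI[of _ _ "(p, v)"]) auto
  qed
qed

lemma cimg_TM: "i \<in> idx M \<Longrightarrow> cimg TM i = cimg M i \<times> UNIV"
proof -
  assume i: "i \<in> idx M"
  have "{w \<in> tb_cdom M i. fst w \<in> cdom M i} = tb_cdom M i" by (auto simp: tb_cdom_iff)
  then show ?thesis using tb_chart_image[OF i, of "cdom M i"] by (simp add: cimg_def)
qed

lemma overlap_TM: "i \<in> idx M \<Longrightarrow> overlap TM i j = overlap M i j \<times> UNIV"
proof -
  assume i: "i \<in> idx M"
  have "tb_cdom M i \<inter> tb_cdom M j = {w \<in> tb_cdom M i. fst w \<in> cdom M i \<inter> cdom M j}"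
    by (auto simp: tb_cdom_iff)
  then show ?thesis using tb_chart_image[OF i, of "cdom M i \<inter> cdom M j"] by (simp add: overlap_def)
qed

lemma transition_TM:
  assumes ij: "i \<in> idx M" "j \<in> idx M" and z: "z \<in> overlap M i j \<times> UNIV"
  shows "transition TM i j z = (transition M i j (fst z), jacobian M i j (fst z) (snd z))"
proof -
  obtain w where w: "w \<in> tb_cdom M i" "w \<in> tb_cdom M j" "z = tb_chart M i w"
    using z unfolding overlap_TM[OF ij(1), of j, symmetric] by (auto simp: overlap_def)
  obtain p v where pv: "w = (p, v)" by (cases w)
  have "transition TM i j z = tb_chart M j w"
    using w tb_chart_inj[OF ij(1)] by (simp add: transition_def)
  moreover have "p \<in> cdom M i" "p \<in> cdom M j" using w pv by (auto simp: tb_cdom_iff)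
  ultimately show ?thesis
    using w pv ij tb_cdom_transform[OF ij(1,2), of p v] by (simp add: transition_chart)
qed

lemma transition_TM_smooth:
  assumes ij: "i \<in> idx M" "j \<in> idx M"
  shows "smooth_on (overlap M i j \<times> UNIV) (\<lambda>z. (transition M i j (fst z), jacobian M i j (fst z) (snd z)))"
proof -
  let ?S = "overlap M i j \<times> (UNIV :: 'e set)"
  have S: "open ?S" by (intro open_Times overlap_open ij open_UNIV)
  have fst: "smooth_on ?S fst" and snd: "smooth_on ?S snd"
    by (intro smooth_on_bounded_linear S bounded_linear_fst bounded_linear_snd)+
  have J: "smooth_on ?S (\<lambda>z. jacobian M i j (fst z) u)" for u
    by (rule smooth_on_compose[OF overlap_open[OF ij] S jacobian_smooth[OF ij] fst]) auto
  show ?thesis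
    by (intro smooth_on_Pair S smooth_on_compose[OF overlap_open[OF ij] S transition_smooth[OF ij] fst]
        smooth_on_linear_family[OF S _ J snd] jacobian_linear ij) auto
qed

lemma openin_TM_chart:
  "i \<in> idx M \<Longrightarrow> open W \<Longrightarrow> openin (mtop TM) {w \<in> tb_cdom M i. tb_chart M i w \<in> W}"
  by (auto simp: tangent_bundle_def intro!: topology_generated_by_Basis)

lemma tb_cdom_open: "i \<in> idx M \<Longrightarrow> openin (mtop TM) (tb_cdom M i)"
  using openin_TM_chart[of i UNIV] by simp

lemma topspace_TM: "topspace (mtop TM) = (\<Union>i\<in>idx M. tb_cdom M i)"
proof
  show "topspace (mtop TM) \<subseteq> (\<Union>i\<in>idx M. tb_cdom M i)" by (auto simp: tangent_bundle_def)
  show "(\<Union>i\<in>idx M. tb_cdom M i) \<subseteq> topspace (mtop TM)" using tb_cdom_open openin_subset by blast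
qed

text \<open>The inverse of a bundle chart is continuous because the preimage of a generating open set, taken from the
  chart \<open>j\<close>, is the preimage of an open set under the transition map from \<open>i\<close> to \<open>j\<close>.\<close>

lemma tb_chart_homeo:
  assumes i: "i \<in> idx M"
  shows "homeomorphic_map (subtopology (mtop TM) (tb_cdom M i)) (top_of_set (cimg M i \<times> UNIV)) (tb_chart M i)"
proof -
  let ?S = "cimg M i \<times> (UNIV :: 'e set)"
  define s where "s = inv_into (tb_cdom M i) (tb_chart M i)"
  have img: "tb_chart M i ` tb_cdom M i = ?S" using cimg_TM[OF i] by (simp add: cimg_def)
  have sf: "s (tb_chart M i w) = w" if "w \<in> tb_cdom M i" for w
    unfolding s_def using that tb_chart_inj[OF i] by simp
  have fs: "tb_chart M i (s z) = z" and sin: "s z \<in> tb_cdom M i" if "z \<in> ?S" for z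
    using that img by (metis s_def f_inv_into_f inv_into_into)+
  have top: "topspace (subtopology (mtop TM) (tb_cdom M i)) = tb_cdom M i"
    using openin_subset[OF tb_cdom_open[OF i]] by auto
  have S: "open ?S" using cimg_open[OF i] by (simp add: open_Times)
  have f: "continuous_map (subtopology (mtop TM) (tb_cdom M i)) (top_of_set ?S) (tb_chart M i)"
    unfolding continuous_map_def top
  proof (intro conjI allI impI)
    show "tb_chart M i \<in> tb_cdom M i \<rightarrow> topspace (top_of_set ?S)" using img by auto
    fix W assume "openin (top_of_set ?S) W"
    then have "open W" using S openin_open_eq by blast
    then show "openin (subtopology (mtop TM) (tb_cdom M i)) {w \<in> tb_cdom M i. tb_chart M i w \<in> W}"
      using openin_TM_chart[OF i] openin_open_subtopology[OF tb_cdom_open[OF i]] by auto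
  qed
  have "continuous_map (top_of_set ?S) (mtop TM) s"
    unfolding tangent_bundle_def atlas.simps
  proof (rule continuous_on_generated_topo)
    fix U assume "U \<in> {{w \<in> tb_cdom M i. tb_chart M i w \<in> W} | i W. i \<in> idx M \<and> open W}"
    then obtain j W where jW: "U = {w \<in> tb_cdom M j. tb_chart M j w \<in> W}" "j \<in> idx M" "open W" by blast
    let ?t = "\<lambda>z. (transition M i j (fst z), jacobian M i j (fst z) (snd z))"
    have "s -` U \<inter> ?S = (overlap M i j \<times> UNIV) \<inter> ?t -` W"
    proof (intro set_eqI iffI)
      fix z assume z: "z \<in> s -` U \<inter> ?S"
      then have "s z \<in> tb_cdom M i \<inter> tb_cdom M j" "tb_chart M i (s z) = z" "tb_chart M j (s z) \<in> W"
        using jW sin fs by auto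
      moreover from this have "z \<in> overlap TM i j" by (auto simp: overlap_def intro!: image_eqI[of _ _ "s z"])
      moreover from calculation have "transition TM i j z = tb_chart M j (s z)"
        using tb_chart_inj[OF i] by (metis IntD1 TM_simps(2,3) inv_into_f_f transition_def)
      ultimately show "z \<in> (overlap M i j \<times> UNIV) \<inter> ?t -` W"
        using transition_TM[OF i jW(2)] overlap_TM[OF i] by auto
    next
      fix z assume z: "z \<in> (overlap M i j \<times> UNIV) \<inter> ?t -` W"
      then have "z \<in> overlap TM i j" using overlap_TM[OF i] by auto
      then obtain w where w: "w \<in> tb_cdom M i" "w \<in> tb_cdom M j" "z = tb_chart M i w"
        by (auto simp: overlap_def)
      then have sz: "s z = w" by (simp add: sf)
      have "transition TM i j z = tb_chart M j w"
        using w tb_chart_inj[OF i] by (simp add: transition_def)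
      then have "tb_chart M j w \<in> W" using transition_TM[OF i jW(2)] z by auto
      then show "z \<in> s -` U \<inter> ?S" using jW sz w img by auto
    qed
    moreover have "open ((overlap M i j \<times> UNIV) \<inter> ?t -` W)"
      using smooth_on_continuous[OF transition_TM_smooth[OF i jW(2)]] overlap_open[OF i jW(2)] jW(3)
      by (intro continuous_open_preimage open_Times open_UNIV)
    ultimately show "openin (top_of_set ?S) (s -` U \<inter> topspace (top_of_set ?S))"
      using S overlap_subset[of i j] by (auto simp: openin_open_eq)
  next
    show "s ` topspace (top_of_set ?S) \<subseteq> \<Union> {{w \<in> tb_cdom M i. tb_chart M i w \<in> W} | i W. i \<in> idx M \<and> open W}"
    proof
      fix w assume "w \<in> s ` topspace (top_of_set ?S)"
      then have "w \<in> {w \<in> tb_cdom M i. tb_chart M i w \<in> UNIV}" using sin by auto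
      then show "w \<in> \<Union> {{w \<in> tb_cdom M i. tb_chart M i w \<in> W} | i W. i \<in> idx M \<and> open W}"
        using i open_UNIV by blast
    qed
  qed
  then have "continuous_map (top_of_set ?S) (subtopology (mtop TM) (tb_cdom M i)) s"
    using sin by (auto simp: continuous_map_in_subtopology)
  then have "homeomorphic_maps (subtopology (mtop TM) (tb_cdom M i)) (top_of_set ?S) (tb_chart M i) s"
    unfolding homeomorphic_maps_def using f sf fs top by auto
  then show ?thesis using homeomorphic_map_maps by blast
qed

lemma tb_chart_image_open:
  assumes i: "i \<in> idx M" and U: "openin (mtop TM) U" "U \<subseteq> tb_cdom M i"
  shows "open (tb_chart M i ` U)"
proof -
  have "openin (subtopology (mtop TM) (tb_cdom M i)) U"
    using U openin_open_subtopology[OF tb_cdom_open[OF i]] by blast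
  then have "openin (top_of_set (cimg M i \<times> UNIV)) (tb_chart M i ` U)"
    using homeomorphic_map_openness[OF tb_chart_homeo[OF i], of U] openin_subset by blast
  then show ?thesis using openin_open_eq[OF open_Times[OF cimg_open[OF i] open_UNIV]] by blast
qed

lemma tb_projection_open:
  assumes U: "openin (mtop M) U"
  shows "openin (mtop TM) {w \<in> topspace (mtop TM). fst w \<in> U}"
proof -
  have eq: "{w \<in> topspace (mtop TM). fst w \<in> U} =
    (\<Union>i\<in>idx M. {w \<in> tb_cdom M i. tb_chart M i w \<in> (chart M i ` (U \<inter> cdom M i)) \<times> UNIV})"
  proof -
    have "p \<in> U" if "i \<in> idx M" "(p, v) \<in> tb_cdom M i" "chart M i p \<in> chart M i ` (U \<inter> cdom M i)" for i p v
      using that inj_onD[OF chart_inj[OF that(1)]] by (auto simp: tb_cdom_iff)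
    then show ?thesis unfolding topspace_TM by (auto simp: tb_cdom_iff)
  qed
  show ?thesis unfolding eq
    using U by (intro openin_Union) (auto intro!: openin_TM_chart open_Times chart_image_open openin_Int cdom_open)
qed

text \<open>Points over distinct base points are separated by open sets of \<open>M\<close>; points of one fibre lie in a common
  bundle chart and are separated there.\<close>

lemma Hausdorff_TM: "Hausdorff_space (mtop TM)"
  unfolding Hausdorff_space_def
proof (intro allI impI, elim conjE)
  fix w w' assume w: "w \<in> topspace (mtop TM)" "w' \<in> topspace (mtop TM)" "w \<noteq> w'"
  have M: "Hausdorff_space (mtop M)" using smooth_manifold by (simp add: smooth_manifold_def)
  show "\<exists>U V. openin (mtop TM) U \<and> openin (mtop TM) V \<and> w \<in> U \<and> w' \<in> V \<and> disjnt U V"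
  proof (cases "fst w = fst w'")
    case False
    have "fst w \<in> topspace (mtop M)" "fst w' \<in> topspace (mtop M)"
      using w cdom_cover by (auto simp: topspace_TM tb_cdom_iff)
    then obtain U V where UV: "openin (mtop M) U" "openin (mtop M) V" "fst w \<in> U" "fst w' \<in> V" "disjnt U V"
      using M False unfolding Hausdorff_space_def by metis
    show ?thesis
      using w UV tb_projection_open[OF UV(1)] tb_projection_open[OF UV(2)]
      by (intro exI[of _ "{w \<in> topspace (mtop TM). fst w \<in> U}"] exI[of _ "{w \<in> topspace (mtop TM). fst w \<in> V}"])
         (auto simp: disjnt_def)
  next
    case True
    obtain i where i: "i \<in> idx M" "w \<in> tb_cdom M i" using w by (auto simp: topspace_TM)
    have "w' \<in> tb_cdom M i" using i w True by (auto simp: topspace_TM tb_cdom_iff)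
    moreover from this have "tb_chart M i w \<noteq> tb_chart M i w'"
      using inj_onD[OF tb_chart_inj[OF i(1)]] i w(3) by blast
    then obtain U V where UV: "open U" "open V" "tb_chart M i w \<in> U" "tb_chart M i w' \<in> V" "U \<inter> V = {}"
      using hausdorff by metis
    ultimately show ?thesis
      using i openin_TM_chart[OF i(1) UV(1)] openin_TM_chart[OF i(1) UV(2)]
      by (intro exI[of _ "{w \<in> tb_cdom M i. tb_chart M i w \<in> U}"] exI[of _ "{w \<in> tb_cdom M i. tb_chart M i w \<in> V}"])
         (auto simp: disjnt_def)
  qed
qed

text \<open>The index set of the atlas may be uncountable; the Lindeloef property of \<open>M\<close> provides the countably
  many charts from which a countable base of \<open>TM\<close> is built.\<close>

lemma countable_subatlas: "\<exists>C. countable C \<and> C \<subseteq> idx M \<and> (\<Union>i\<in>C. cdom M i) = topspace (mtop M)"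
proof -
  have "Lindelof_space (mtop M)"
    using smooth_manifold second_countable_imp_Lindelof_space by (auto simp: smooth_manifold_def)
  then have "\<exists>\<V>. countable \<V> \<and> \<V> \<subseteq> cdom M ` idx M \<and> \<Union>\<V> = topspace (mtop M)"
    unfolding Lindelof_space_def using cdom_open cdom_cover by (auto dest!: spec[of _ "cdom M ` idx M"])
  then obtain \<V> where V: "countable \<V>" "\<V> \<subseteq> cdom M ` idx M" "\<Union>\<V> = topspace (mtop M)" by (elim exE conjE)
  then obtain C where "countable C" "C \<subseteq> idx M" "\<V> = cdom M ` C"
    using countable_subset_image[of \<V> "cdom M" "idx M"] by blast
  then show ?thesis using V(3) by blast
qed

lemma second_countable_TM: "second_countable (mtop TM)"
proof -
  obtain C where C: "countable C" "C \<subseteq> idx M" "(\<Union>i\<in>C. cdom M i) = topspace (mtop M)"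
    using countable_subatlas by blast
  obtain B :: "('e \<times> 'e) set set" where B: "countable B" "topological_basis B"
    using ex_countable_basis by blast
  let ?b = "\<lambda>(i, W). {w \<in> tb_cdom M i. tb_chart M i w \<in> W}"
  show ?thesis
    unfolding second_countable_def
  proof (intro exI[of _ "?b ` (C \<times> B)"] conjI ballI allI impI)
    show "countable (?b ` (C \<times> B))" using C B by auto
    show "openin (mtop TM) V" if "V \<in> ?b ` (C \<times> B)" for V
      using that C(2) openin_TM_chart topological_basis_open[OF B(2)] by auto
    fix U w assume Uw: "openin (mtop TM) U \<and> w \<in> U"
    then have "w \<in> topspace (mtop TM)" using openin_subset by blast
    then have "w \<in> tangent_vectors M" "fst w \<in> topspace (mtop M)"
      using cdom_cover by (auto simp: topspace_TM tb_cdom_iff)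
    then obtain i where i: "i \<in> C" "w \<in> tb_cdom M i" using C(3) by (auto simp: tb_cdom_iff)
    then have iM: "i \<in> idx M" using C(2) by blast
    have "open (tb_chart M i ` (U \<inter> tb_cdom M i))"
      using Uw by (intro tb_chart_image_open iM openin_Int tb_cdom_open) auto
    then obtain W where W: "W \<in> B" "tb_chart M i w \<in> W" "W \<subseteq> tb_chart M i ` (U \<inter> tb_cdom M i)"
      using topological_basisE[OF B(2), of _ "tb_chart M i w"] Uw i by blast
    have "w' \<in> U" if w': "w' \<in> tb_cdom M i" "tb_chart M i w' \<in> W" for w'
    proof -
      obtain w'' where "w'' \<in> U" "w'' \<in> tb_cdom M i" "tb_chart M i w' = tb_chart M i w''"
        using W(3) w'(2) by blast
      then show ?thesis using inj_onD[OF tb_chart_inj[OF iM]] w'(1) by metis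
    qed
    then have "?b (i, W) \<subseteq> U" by auto
    then show "\<exists>V\<in>?b ` (C \<times> B). w \<in> V \<and> V \<subseteq> U" using i W by blast
  qed
qed

lemma smooth_manifold_TM: "smooth_manifold TM"
  unfolding smooth_manifold_def
proof (intro conjI ballI)
  fix i assume i: "i \<in> idx TM"
  show "openin (mtop TM) (cdom TM i)" using i tb_cdom_open by simp
  show "open (cimg TM i)" using i cimg_TM cimg_open by (simp add: open_Times)
  show "homeomorphic_map (subtopology (mtop TM) (cdom TM i)) (top_of_set (cimg TM i)) (chart TM i)"
    using i tb_chart_homeo cimg_TM by simp
  fix j assume j: "j \<in> idx TM"
  show "smooth_on (overlap TM i j) (transition TM i j)"
    using i j transition_TM_smooth[of i j] transition_TM[of i j] overlap_TM overlap_open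
    by (subst smooth_on_cong) (auto simp: open_Times)
qed (auto simp: Hausdorff_TM second_countable_TM topspace_TM)

text \<open>The derivative of \<open>(x, y) \<mapsto> (\<phi> x, \<phi>' x y)\<close>: the Hessian of \<open>\<phi>\<close> enters the second component.\<close>

lemma jacobian_TM:
  assumes ij: "i \<in> idx M" "j \<in> idx M" and x: "x \<in> overlap M i j"
  shows "jacobian TM i j (x, y) A = (jacobian M i j x (fst A),
     frechet_derivative (\<lambda>z. jacobian M i j z y) (at x) (fst A) + jacobian M i j x (snd A))"
proof -
  let ?S = "overlap M i j \<times> (UNIV :: 'e set)"
  have S: "open ?S" "(x, y) \<in> ?S" using x overlap_open[OF ij] by (auto simp: open_Times)
  have fst: "(fst has_derivative fst) (at (x, y))" and snd: "(snd has_derivative snd) (at (x, y))"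
    by (auto intro!: derivative_eq_intros)
  have J: "((\<lambda>z. jacobian M i j (fst z) u) has_derivative
      (\<lambda>v. frechet_derivative (\<lambda>z. jacobian M i j z u) (at x) (fst v))) (at (x, y))" for u
    using has_derivative_compose[OF fst, of "\<lambda>z. jacobian M i j z u"]
      smooth_on_has_derivative[OF jacobian_smooth[OF ij] x] by simp
  have Jeq: "frechet_derivative (\<lambda>z. jacobian M i j (fst z) u) (at (x, y)) v =
      frechet_derivative (\<lambda>z. jacobian M i j z u) (at x) (fst v)" for u v
    using frechet_derivative_at[OF J] by metis
  have "((\<lambda>z. jacobian M i j (fst z) (snd z)) has_derivative
      (\<lambda>v. frechet_derivative (\<lambda>z. jacobian M i j (fst z) (snd (x, y))) (at (x, y)) v
        + jacobian M i j (fst (x, y)) (snd v))) (at (x, y))"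
    using J differentiable_def ij
    by (intro linear_family_derivative(2)[OF S _ _ snd]) (auto intro!: jacobian_linear)
  then have "((\<lambda>z. (transition M i j (fst z), jacobian M i j (fst z) (snd z))) has_derivative
    (\<lambda>A. (jacobian M i j x (fst A), frechet_derivative (\<lambda>z. jacobian M i j z y) (at x) (fst A)
      + jacobian M i j x (snd A)))) (at (x, y))"
    using has_derivative_compose[OF fst, of "transition M i j" "jacobian M i j x"] transition_has_derivative[OF ij x]
    by (intro has_derivative_Pair) (simp_all add: Jeq)
  then have "(transition TM i j has_derivative
    (\<lambda>A. (jacobian M i j x (fst A), frechet_derivative (\<lambda>z. jacobian M i j z y) (at x) (fst A)
      + jacobian M i j x (snd A)))) (at (x, y))"
    by (rule has_derivative_transform_within_open[OF _ S]) (simp add: transition_TM[OF ij])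
  from frechet_derivative_at[OF this, symmetric] show ?thesis by (simp add: jacobian_def[of TM])
qed

end

section \<open>Connection and curvature in a chart\<close>

text \<open>A nondegenerate metric on the image of a single chart. The locale is used for \<open>g\<close> on \<open>M\<close> and, with the
  Sasaki metric in the role of \<open>g\<close>, for the image of a bundle chart.\<close>

locale local_metric =
  fixes g :: "'i \<Rightarrow> 'e::euclidean_space \<Rightarrow> 'e \<Rightarrow> 'e \<Rightarrow> real" and i :: 'i and S :: "'e set"
  assumes S: "open S"
    and bil: "\<And>x. x \<in> S \<Longrightarrow> bilinear (g i x)"
    and sym: "\<And>x u v. x \<in> S \<Longrightarrow> g i x u v = g i x v u"
    and smooth: "\<And>u v. smooth_on S (\<lambda>x. g i x u v)"
    and nondegenerate: "\<And>x w. x \<in> S \<Longrightarrow> (\<And>z. g i x w z = 0) \<Longrightarrow> w = 0"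
begin

abbreviation "\<Gamma> \<equiv> christoffel (g i)"

lemma metric_linear:
  assumes "x \<in> S"
  shows "g i x (u + v) w = g i x u w + g i x v w" "g i x w (u + v) = g i x w u + g i x w v"
    "g i x (c *\<^sub>R u) w = c * g i x u w" "g i x w (c *\<^sub>R u) = c * g i x w u"
    "g i x (u - v) w = g i x u w - g i x v w" "g i x w (u - v) = g i x w u - g i x w v"
    "g i x (- u) w = - g i x u w" "g i x w (- u) = - g i x w u"
    "g i x 0 w = 0" "g i x w 0 = 0"
  using bil[OF assms]
  by (simp_all add: bilinear_ladd bilinear_radd bilinear_lmul bilinear_rmul bilinear_lsub bilinear_rsub
      bilinear_lneg bilinear_rneg bilinear_lzero bilinear_rzero)

lemma metric_cancel:
  assumes "x \<in> S" "\<And>z. g i x u z = g i x v z"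
  shows "u = v"
  using nondegenerate[OF assms(1), of "u - v"] assms by (simp add: metric_linear)

lemma christoffel_ex1:
  assumes "x \<in> S"
  shows "\<exists>!G. bilinear G \<and> (\<forall>u v. G u v = G v u) \<and>
     (\<forall>u v w. frechet_derivative (\<lambda>z. g i z u v) (at x) w = g i x (G w u) v + g i x u (G w v))"
  using christoffel_exists1[OF S assms bil sym smooth_on_differentiable[OF smooth assms] nondegenerate[OF assms]]
  by blast

lemma christoffel_works:
  assumes "x \<in> S"
  shows "bilinear (\<Gamma> x)" "\<Gamma> x u v = \<Gamma> x v u"
    "frechet_derivative (\<lambda>z. g i z u v) (at x) w = g i x (\<Gamma> x w u) v + g i x u (\<Gamma> x w v)"
  using theI'[OF christoffel_ex1[OF assms]] unfolding christoffel_def[symmetric] by blast+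

lemma christoffel_unique:
  assumes "x \<in> S" "bilinear G" "\<And>u v. G u v = G v u"
    "\<And>u v w. frechet_derivative (\<lambda>z. g i z u v) (at x) w = g i x (G w u) v + g i x u (G w v)"
  shows "\<Gamma> x = G"
  unfolding christoffel_def using assms by (intro the1_equality[OF christoffel_ex1]) auto

lemma christoffel_linear:
  assumes "x \<in> S"
  shows "\<Gamma> x (u + v) w = \<Gamma> x u w + \<Gamma> x v w" "\<Gamma> x w (u + v) = \<Gamma> x w u + \<Gamma> x w v"
    "\<Gamma> x (c *\<^sub>R u) w = c *\<^sub>R \<Gamma> x u w" "\<Gamma> x w (c *\<^sub>R u) = c *\<^sub>R \<Gamma> x w u"
    "\<Gamma> x (u - v) w = \<Gamma> x u w - \<Gamma> x v w" "\<Gamma> x w (u - v) = \<Gamma> x w u - \<Gamma> x w v"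
    "\<Gamma> x (- u) w = - \<Gamma> x u w" "\<Gamma> x w (- u) = - \<Gamma> x w u"
    "\<Gamma> x 0 w = 0" "\<Gamma> x w 0 = 0"
  using christoffel_works(1)[OF assms]
  by (simp_all add: bilinear_ladd bilinear_radd bilinear_lmul bilinear_rmul bilinear_lsub bilinear_rsub
      bilinear_lneg bilinear_rneg bilinear_lzero bilinear_rzero)

lemma koszul:
  assumes x: "x \<in> S"
  shows "2 * g i x (\<Gamma> x u v) w = frechet_derivative (\<lambda>z. g i z v w) (at x) u
    + frechet_derivative (\<lambda>z. g i z u w) (at x) v - frechet_derivative (\<lambda>z. g i z u v) (at x) w"
  unfolding christoffel_works(3)[OF x]
  using christoffel_works(2)[OF x] sym[OF x] by (smt (verit))

text \<open>In coordinates the Koszul formula says that \<open>\<Gamma> x u v\<close> is the solution of a linear system whose matrix is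
  the matrix of the metric, which is invertible by nondegeneracy.\<close>

lemma christoffel_smooth: "smooth_on S (\<lambda>x. \<Gamma> x u v)"
proof -
  define L where "L x w = (\<Sum>e\<in>Basis. g i x w e *\<^sub>R e)" for x and w :: 'e
  define K where "K x e = frechet_derivative (\<lambda>z. g i z v e) (at x) u
    + frechet_derivative (\<lambda>z. g i z u e) (at x) v - frechet_derivative (\<lambda>z. g i z u v) (at x) e" for x e
  have smK: "smooth_on S (\<lambda>x. \<Sum>e\<in>Basis. (K x e / 2) *\<^sub>R e)"
    unfolding K_def divide_inverse
    by (rule smooth_on_sum[OF S], rule smooth_on_scaleR[OF S smooth_on_mult[OF S _ smooth_on_const] smooth_on_const])
       (intro smooth_on_diff smooth_on_add smooth_on_frechet S smooth)
  show ?thesis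
  proof (rule smooth_on_solution_linear_family[OF S, of L])
    fix x assume x: "x \<in> S"
    show lin: "linear (L x)"
      unfolding L_def by (rule linearI) (simp_all add: metric_linear[OF x] sum.distrib scaleR_add_left scaleR_sum_right)
    show "inj (L x)"
    proof (subst linear_injective_0[OF lin], intro allI impI)
      fix w assume "L x w = 0"
      then have "g i x w e = 0" if "e \<in> Basis" for e
        using that inner_sum_left_Basis[of e "g i x w"] by (simp add: L_def)
      moreover have "linear (g i x w)" using bil[OF x] by (simp add: bilinear_def)
      ultimately have "g i x w z = 0" for z
        using euclidean_linear_sum[of "g i x w" z] by simp
      then show "w = 0" using nondegenerate[OF x] by blast
    qed
    show "L x (\<Gamma> x u v) = (\<Sum>e\<in>Basis. (K x e / 2) *\<^sub>R e)"
      unfolding L_def K_def koszul[OF x, of u v, symmetric] by simp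
  next
    show "smooth_on S (\<lambda>x. L x w)" for w
      unfolding L_def by (rule smooth_on_sum[OF S], rule smooth_on_scaleR[OF S smooth smooth_on_const])
    show "smooth_on S (\<lambda>x. \<Sum>e\<in>Basis. (K x e / 2) *\<^sub>R e)" by (rule smK)
  qed
qed

definition "d\<Gamma> x u v w = frechet_derivative (\<lambda>z. \<Gamma> z v w) (at x) u"

lemma dchristoffel_bilinear: "x \<in> S \<Longrightarrow> bilinear (d\<Gamma> x u)"
  unfolding d\<Gamma>_def
  by (rule bilinear_family_derivative(1)[OF S _ christoffel_works(1) smooth_on_differentiable[OF christoffel_smooth]
        has_derivative_const has_derivative_const])

lemma dchristoffel_linear: "x \<in> S \<Longrightarrow> linear (\<lambda>u. d\<Gamma> x u v w)"
  unfolding d\<Gamma>_def by (intro linear_frechet_derivative smooth_on_differentiable[OF christoffel_smooth])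

lemma dchristoffel_sym:
  assumes "x \<in> S" shows "d\<Gamma> x u v w = d\<Gamma> x u w v"
  unfolding d\<Gamma>_def
  by (subst frechet_derivative_transform_within_open[OF _ S assms christoffel_works(2)])
     (auto intro: smooth_on_differentiable[OF christoffel_smooth assms])

lemma christoffel_derivative:
  assumes x: "x \<in> S" and f: "(f has_derivative f') (at x)" and h: "(h has_derivative h') (at x)"
  shows "((\<lambda>z. \<Gamma> z (f z) (h z)) has_derivative
    (\<lambda>v. d\<Gamma> x v (f x) (h x) + \<Gamma> x (f' v) (h x) + \<Gamma> x (f x) (h' v))) (at x)"
  unfolding d\<Gamma>_def
  by (rule bilinear_family_derivative(2)[OF S x christoffel_works(1) smooth_on_differentiable[OF christoffel_smooth x] f h])

text \<open>The coordinate expression of \<open>R(u, v)w\<close>.\<close>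

definition "curv x u v w = d\<Gamma> x u v w - d\<Gamma> x v u w + \<Gamma> x u (\<Gamma> x v w) - \<Gamma> x v (\<Gamma> x u w)"

lemma covderiv_has_derivative:
  assumes x: "x \<in> S" and Y: "smooth_on S Y" and Z: "smooth_on S Z"
  shows "(covderiv (g i) Y Z has_derivative (\<lambda>v.
     frechet_derivative (\<lambda>z. frechet_derivative Z (at z) (Y x)) (at x) v
     + frechet_derivative Z (at x) (frechet_derivative Y (at x) v)
     + (d\<Gamma> x v (Y x) (Z x) + \<Gamma> x (frechet_derivative Y (at x) v) (Z x)
        + \<Gamma> x (Y x) (frechet_derivative Z (at x) v)))) (at x)"
  unfolding covderiv_def dirderiv_def
proof (rule has_derivative_add)
  show "((\<lambda>x. frechet_derivative Z (at x) (Y x)) has_derivative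
     (\<lambda>v. frechet_derivative (\<lambda>z. frechet_derivative Z (at z) (Y x)) (at x) v
        + frechet_derivative Z (at x) (frechet_derivative Y (at x) v))) (at x)"
    by (rule linear_family_derivative(2)[OF S x linear_frechet_derivative[OF smooth_on_differentiable[OF Z]]
          smooth_on_differentiable[OF smooth_on_frechet[OF Z] x] smooth_on_has_derivative[OF Y x]])
  show "((\<lambda>x. \<Gamma> x (Y x) (Z x)) has_derivative
     (\<lambda>v. d\<Gamma> x v (Y x) (Z x) + \<Gamma> x (frechet_derivative Y (at x) v) (Z x)
        + \<Gamma> x (Y x) (frechet_derivative Z (at x) v))) (at x)"
    by (rule christoffel_derivative[OF x smooth_on_has_derivative[OF Y x] smooth_on_has_derivative[OF Z x]])
qed

text \<open>The second derivatives of \<open>Z\<close> cancel by symmetry, and the terms with first derivatives of \<open>X\<close> and \<open>Y\<close>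
  are those of the Lie bracket; the rest depends only on the values at \<open>x\<close>.\<close>

lemma curvature_eq:
  assumes x: "x \<in> S" and X: "smooth_on S X" and Y: "smooth_on S Y" and Z: "smooth_on S Z"
  shows "curvature (g i) X Y Z x = curv x (X x) (Y x) (Z x)"
proof -
  define D where "D F = frechet_derivative F (at x)" for F :: "'e \<Rightarrow> 'e"
  define D2 where "D2 u v = D (\<lambda>z. frechet_derivative Z (at z) u) v" for u v
  have lin: "linear (D Z)" unfolding D_def using linear_frechet_derivative[OF smooth_on_differentiable[OF Z x]] .
  have cov: "covderiv (g i) X (covderiv (g i) Y Z) x = D2 (Y x) (X x) + D Z (D Y (X x))
     + (d\<Gamma> x (X x) (Y x) (Z x) + \<Gamma> x (D Y (X x)) (Z x) + \<Gamma> x (Y x) (D Z (X x)))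
     + \<Gamma> x (X x) (D Z (Y x) + \<Gamma> x (Y x) (Z x))"
    if "smooth_on S Y" for X Y
    unfolding D2_def D_def
    by (subst covderiv_def, subst dirderiv_def,
        subst frechet_derivative_at[OF covderiv_has_derivative[OF x that Z], symmetric])
       (simp add: covderiv_def dirderiv_def)
  have "D2 (Y x) (X x) = D2 (X x) (Y x)"
    unfolding D2_def D_def by (rule symmetric_second_derivative[OF S x Z])
  then show ?thesis
    unfolding curvature_def cov[OF X] cov[OF Y]
    by (simp add: covderiv_def lie_bracket_def dirderiv_def curv_def D_def[symmetric]
        linear_diff[OF lin] christoffel_linear[OF x])
qed

lemma flat_iff:
  "(\<forall>X Y Z. smooth_on S X \<and> smooth_on S Y \<and> smooth_on S Z \<longrightarrow> (\<forall>x\<in>S. curvature (g i) X Y Z x = 0))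
    \<longleftrightarrow> (\<forall>x\<in>S. \<forall>u v w. curv x u v w = 0)" (is "?flat \<longleftrightarrow> ?c")
proof
  assume flat: ?flat
  show ?c
  proof (intro ballI allI)
    fix x u v w assume x: "x \<in> S"
    have "curvature (g i) (\<lambda>_. u) (\<lambda>_. v) (\<lambda>_. w) x = 0" using flat x by auto
    then show "curv x u v w = 0" by (simp add: curvature_eq[OF x])
  qed
qed (simp add: curvature_eq)

section \<open>Horizontal and vertical parts in a bundle chart\<close>

text \<open>The vertical part at a point \<open>z\<close> of the bundle chart, as a function of \<open>z\<close>; the horizontal part is \<open>fst\<close>.
  Identities between tangent vectors of the bundle are proved on these two parts.\<close>

definition "ver z A = snd A + \<Gamma> (fst z) (snd z) (fst A)"

abbreviation "TS \<equiv> S \<times> (UNIV :: 'e set)"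

lemma TS_open: "open TS"
  by (intro open_Times S open_UNIV)

lemma sasaki_eq: "sasaki g i z A B = g i (fst z) (fst A) (fst B) + g i (fst z) (ver z A) (ver z B)"
  by (cases z) (simp add: sasaki_def Let_def hor_part_def ver_part_def ver_def)

lemma J1_eq: "tb_J1 g i z A = (- ver z A, fst A + \<Gamma> (fst z) (snd z) (ver z A))"
  by (cases z) (simp add: tb_J1_def Let_def hor_part_def ver_part_def ver_def hor_lift_def ver_lift_def)

lemma ver_linear: "z \<in> TS \<Longrightarrow> linear (ver z)"
  by (rule linearI) (auto simp: ver_def christoffel_linear scaleR_add_right)

lemma hor_ver_eqI: "fst A = fst B \<Longrightarrow> ver z A = ver z B \<Longrightarrow> A = B"
  by (cases A, cases B) (simp add: ver_def)

lemma hor_ver_exists: "\<exists>A. fst A = u \<and> ver z A = v"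
  by (rule exI[of _ "(u, v - \<Gamma> (fst z) (snd z) u)"]) (simp add: ver_def)

lemma fst_J1: "fst (tb_J1 g i z A) = - ver z A"
  by (simp add: J1_eq)

lemma ver_J1: "z \<in> TS \<Longrightarrow> ver z (tb_J1 g i z A) = fst A"
  by (auto simp: J1_eq ver_def christoffel_linear)

lemma ver_smooth: "smooth_on TS (\<lambda>z. ver z A)"
proof -
  have fst: "smooth_on TS fst" and snd: "smooth_on TS snd"
    by (intro smooth_on_bounded_linear TS_open bounded_linear_fst bounded_linear_snd)+
  have G: "smooth_on TS (\<lambda>z. \<Gamma> (fst z) u v)" for u v
    by (rule smooth_on_compose[OF S TS_open christoffel_smooth fst]) auto
  have "smooth_on TS (\<lambda>z. \<Gamma> (fst z) (snd z) (fst A))"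
    by (rule smooth_on_bilinear_family[OF TS_open _ G snd smooth_on_const]) (auto intro: christoffel_works)
  then show ?thesis unfolding ver_def by (intro smooth_on_add TS_open smooth_on_const)
qed

definition "dver z A B = frechet_derivative (\<lambda>z. ver z B) (at z) A"

lemma ver_has_derivative: "z \<in> TS \<Longrightarrow> ((\<lambda>z. ver z B) has_derivative (\<lambda>A. dver z A B)) (at z)"
  unfolding dver_def by (rule smooth_on_has_derivative[OF ver_smooth])

lemma dver_eq:
  assumes z: "z \<in> TS"
  shows "dver z A B = d\<Gamma> (fst z) (fst A) (snd z) (fst B) + \<Gamma> (fst z) (snd A) (fst B)"
proof -
  have x: "fst z \<in> S" using z by auto
  define b where "b = fst B"
  have fst: "(fst has_derivative fst) (at z)" and snd: "(snd has_derivative snd) (at z)"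
    by (auto intro!: derivative_eq_intros)
  have G: "((\<lambda>z. \<Gamma> (fst z) u v) has_derivative (\<lambda>A. d\<Gamma> (fst z) (fst A) u v)) (at z)" for u v
    unfolding d\<Gamma>_def
    by (rule has_derivative_compose[OF fst smooth_on_has_derivative[OF christoffel_smooth x]])
  have Gd: "(\<lambda>z. \<Gamma> (fst z) u v) differentiable (at z)" for u v
    using G unfolding differentiable_def by blast
  have "((\<lambda>z. \<Gamma> (fst z) (snd z) b) has_derivative (\<lambda>A.
      frechet_derivative (\<lambda>w. \<Gamma> (fst w) (snd z) b) (at z) A + \<Gamma> (fst z) (snd A) b + \<Gamma> (fst z) (snd z) 0)) (at z)"
    by (rule bilinear_family_derivative(2)[OF TS_open z _ Gd snd has_derivative_const]) (auto intro: christoffel_works)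
  then have "((\<lambda>z. ver z B) has_derivative (\<lambda>A. 0 +
      (d\<Gamma> (fst z) (fst A) (snd z) b + \<Gamma> (fst z) (snd A) b))) (at z)"
    unfolding ver_def b_def[symmetric]
    by (intro has_derivative_add has_derivative_const)
       (simp add: frechet_derivative_at[OF G, symmetric] christoffel_linear[OF x])
  from frechet_derivative_at[OF this, symmetric] show ?thesis
    by (simp add: dver_def b_def)
qed

text \<open>The Sasaki metric is the metric \<open>g \<oplus> g\<close> with respect to the pair of linear maps \<open>(fst, ver z)\<close>, which is bijective and
  depends smoothly on \<open>z\<close>. All properties are inherited from \<open>g\<close>.\<close>

lemma sasaki_local_metric: "local_metric (sasaki g) i TS"
proof
  show "open TS" by (rule TS_open)
  have base_smooth: "smooth_on TS (\<lambda>z. g i (fst z) u v)" for u v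
    by (rule smooth_on_compose[OF S TS_open smooth])
       (auto intro: smooth_on_bounded_linear TS_open bounded_linear_fst)
  show "smooth_on TS (\<lambda>z. sasaki g i z A B)" for A B
    unfolding sasaki_eq
    by (intro smooth_on_add TS_open base_smooth smooth_on_bilinear_family[OF TS_open _ base_smooth ver_smooth ver_smooth])
       (auto intro: bil)
  fix z assume z: "z \<in> TS"
  then have x: "fst z \<in> S" by auto
  have v: "linear (ver z)" by (rule ver_linear[OF z])
  show sy: "sasaki g i z A B = sasaki g i z B A" for A B
    unfolding sasaki_eq using sym[OF x] by simp
  have "linear (sasaki g i z A)" for A
    by (rule linearI) (simp_all add: sasaki_eq metric_linear[OF x] linear_add[OF v] linear_scale[OF v] algebra_simps)
  then show "bilinear (sasaki g i z)"
    unfolding bilinear_def using sy by simp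
  fix A assume 0: "\<And>B. sasaki g i z A B = 0"
  have "g i (fst z) (fst A) u + g i (fst z) (ver z A) v = 0" for u v
    using 0 hor_ver_exists[of u z v] by (metis sasaki_eq)
  from this[of _ 0] this[of 0 _] have "fst A = 0" "ver z A = 0"
    by (auto intro!: nondegenerate[OF x] simp: metric_linear[OF x])
  then show "A = 0" using hor_ver_eqI[of A 0 z] linear_0[OF v] by simp
qed

lemma J1_linear: "z \<in> TS \<Longrightarrow> linear (tb_J1 g i z)"
  using ver_linear[of z]
  by (intro linearI) (auto simp: J1_eq linear_add linear_scale christoffel_linear algebra_simps)

lemma J1_J1: "z \<in> TS \<Longrightarrow> tb_J1 g i z (tb_J1 g i z A) = - A"
  by (rule hor_ver_eqI[of _ _ z]) (simp_all add: fst_J1 ver_J1 linear_neg[OF ver_linear])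

lemma J1_smooth: "smooth_on TS (\<lambda>z. tb_J1 g i z A)"
proof -
  have fst: "smooth_on TS fst" and snd: "smooth_on TS snd"
    by (intro smooth_on_bounded_linear TS_open bounded_linear_fst bounded_linear_snd)+
  have G: "smooth_on TS (\<lambda>z. \<Gamma> (fst z) u v)" for u v
    by (rule smooth_on_compose[OF S TS_open christoffel_smooth fst]) auto
  have "smooth_on TS (\<lambda>z. \<Gamma> (fst z) (snd z) (ver z A))"
    by (rule smooth_on_bilinear_family[OF TS_open _ G snd ver_smooth]) (auto intro: christoffel_works)
  then show ?thesis unfolding J1_eq
    by (intro smooth_on_Pair smooth_on_add smooth_on_minus TS_open smooth_on_const ver_smooth)
qed

lemma sasaki_J1_J1: "z \<in> TS \<Longrightarrow> sasaki g i z (tb_J1 g i z A) (tb_J1 g i z B) = sasaki g i z A B"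
  by (auto simp: sasaki_eq fst_J1 ver_J1 metric_linear)

lemma sasaki_J1: "z \<in> TS \<Longrightarrow> sasaki g i z (tb_J1 g i z A) B = - sasaki g i z A (tb_J1 g i z B)"
  by (auto simp: sasaki_eq fst_J1 ver_J1 metric_linear)

end

section \<open>The fundamental form\<close>

text \<open>The square of the exterior derivative is zero: after the product rule the derivatives of the fields cancel
  against the Lie brackets, and the cyclic sum of the remaining second derivatives of \<open>\<theta>\<close> cancels by their
  symmetry.\<close>

lemma ext_deriv_2_exact:
  fixes \<omega> :: "'f::euclidean_space \<Rightarrow> 'f \<Rightarrow> 'f \<Rightarrow> real"
  assumes T: "open T" "x \<in> T" and lin: "\<And>z. z \<in> T \<Longrightarrow> linear (\<theta> z)"
    and smooth: "\<And>a. smooth_on T (\<lambda>z. \<theta> z a)"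
    and \<omega>: "\<And>z a b. z \<in> T \<Longrightarrow> \<omega> z a b =
      frechet_derivative (\<lambda>z. \<theta> z b) (at z) a - frechet_derivative (\<lambda>z. \<theta> z a) (at z) b"
    and A: "smooth_on T A" and B: "smooth_on T B" and C: "smooth_on T C"
  shows "ext_deriv_2 \<omega> A B C x = 0"
proof -
  define Q where "Q a b c = frechet_derivative (\<lambda>z. frechet_derivative (\<lambda>z. \<theta> z a) (at z) b) (at x) c" for a b c
  have Q_sym: "Q a b c = Q a c b" for a b c
    unfolding Q_def by (rule symmetric_second_derivative[OF T smooth])
  have bil: "bilinear (\<omega> z)" if z: "z \<in> T" for z
  proof -
    have l: "linear (\<lambda>a. frechet_derivative (\<lambda>z. \<theta> z a) (at z) b)" for b
      by (rule linear_family_derivative(1)[OF T(1) z lin smooth_on_differentiable[OF smooth z] has_derivative_const])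
    have r: "linear (frechet_derivative (\<lambda>z. \<theta> z a) (at z))" for a
      by (rule linear_frechet_derivative[OF smooth_on_differentiable[OF smooth z]])
    show ?thesis
      unfolding bilinear_def \<omega>[OF z] using l r by (auto intro: linear_compose_sub)
  qed
  have eq: "\<And>z. z \<in> T \<Longrightarrow> frechet_derivative (\<lambda>z. \<theta> z b) (at z) a - frechet_derivative (\<lambda>z. \<theta> z a) (at z) b = \<omega> z a b" for a b
    using \<omega> by simp
  have sm: "smooth_on T (\<lambda>z. \<omega> z a b)" for a b
    by (rule smooth_on_cong[OF T(1) eq, THEN iffD1], assumption)
       (intro smooth_on_diff T(1) smooth_on_frechet smooth)
  have D: "frechet_derivative (\<lambda>z. \<omega> z b c) (at x) a = Q c b a - Q b c a" for a b c
  proof -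
    have "((\<lambda>z. frechet_derivative (\<lambda>z. \<theta> z c) (at z) b - frechet_derivative (\<lambda>z. \<theta> z b) (at z) c)
        has_derivative (\<lambda>a. Q c b a - Q b c a)) (at x)"
      unfolding Q_def by (intro has_derivative_diff smooth_on_has_derivative[OF smooth_on_frechet[OF smooth] T(2)])
    then have "((\<lambda>z. \<omega> z b c) has_derivative (\<lambda>a. Q c b a - Q b c a)) (at x)"
      by (rule has_derivative_transform_within_open[OF _ T eq])
    from frechet_derivative_at[OF this, symmetric] show ?thesis by simp
  qed
  have dir: "dirderiv X (\<lambda>z. \<omega> z (Y z) (Z z)) x = Q (Z x) (Y x) (X x) - Q (Y x) (Z x) (X x)
     + \<omega> x (dirderiv X Y x) (Z x) + \<omega> x (Y x) (dirderiv X Z x)"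
    if "smooth_on T Y" "smooth_on T Z" for X Y Z
  proof -
    have "((\<lambda>z. \<omega> z (Y z) (Z z)) has_derivative (\<lambda>v. frechet_derivative (\<lambda>z. \<omega> z (Y x) (Z x)) (at x) v
      + \<omega> x (frechet_derivative Y (at x) v) (Z x) + \<omega> x (Y x) (frechet_derivative Z (at x) v))) (at x)"
      by (rule bilinear_family_derivative(2)[OF T bil smooth_on_differentiable[OF sm T(2)]
            smooth_on_has_derivative[OF that(1) T(2)] smooth_on_has_derivative[OF that(2) T(2)]])
    from frechet_derivative_at[OF this, symmetric] show ?thesis unfolding dirderiv_def D by simp
  qed
  have skew: "\<omega> x a b = - \<omega> x b a" for a b using \<omega>[OF T(2)] by simp
  show ?thesis
    unfolding ext_deriv_2_def dir[OF B C] dir[OF C A] dir[OF A B] lie_bracket_def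
      bilinear_lsub[OF bil[OF T(2)]]
    using Q_sym[of "A x" "B x" "C x"] Q_sym[of "B x" "A x" "C x"] Q_sym[of "C x" "A x" "B x"]
      skew[of "B x" "dirderiv A C x"] skew[of "C x" "dirderiv B A x"] skew[of "A x" "dirderiv C B x"]
    by linarith
qed

context local_metric
begin

lemma metric_TS_derivative:
  assumes z: "z \<in> TS" and f: "(f has_derivative f') (at z)" and h: "(h has_derivative h') (at z)"
  shows "((\<lambda>z. g i (fst z) (f z) (h z)) has_derivative
    (\<lambda>A. g i (fst z) (f' A + \<Gamma> (fst z) (fst A) (f z)) (h z)
       + g i (fst z) (f z) (h' A + \<Gamma> (fst z) (fst A) (h z)))) (at z)"
proof -
  have x: "fst z \<in> S" using z by auto
  have fst: "(fst has_derivative fst) (at z)" by (auto intro!: derivative_eq_intros)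
  have d: "((\<lambda>z. g i (fst z) u v) has_derivative
     (\<lambda>A. frechet_derivative (\<lambda>x. g i x u v) (at (fst z)) (fst A))) (at z)" for u v
    by (rule has_derivative_compose[OF fst smooth_on_has_derivative[OF smooth x]])
  then have "(\<lambda>z. g i (fst z) u v) differentiable (at z)" for u v
    unfolding differentiable_def by blast
  then have "((\<lambda>z. g i (fst z) (f z) (h z)) has_derivative
    (\<lambda>A. frechet_derivative (\<lambda>w. g i (fst w) (f z) (h z)) (at z) A
      + g i (fst z) (f' A) (h z) + g i (fst z) (f z) (h' A))) (at z)"
    by (intro bilinear_family_derivative(2)[OF TS_open z _ _ f h]) (auto intro: bil)
  then show ?thesis
    by (simp add: frechet_derivative_at[OF d, symmetric] christoffel_works(3)[OF x] metric_linear[OF x] algebra_simps)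
qed

text \<open>The potential is the Liouville form, transported to \<open>TM\<close> by the metric. Differentiating \<open>g(y, HB)\<close> in the
  direction \<open>A\<close> gives \<open>g(VA, HB) + g(y, \<Gamma>(HA, HB))\<close> for constant \<open>B\<close>; the second term is
  symmetric and disappears on antisymmetrization.\<close>

lemma fundamental_form_closed:
  assumes z: "z \<in> TS" and ABC: "smooth_on TS A" "smooth_on TS B" "smooth_on TS C"
  shows "ext_deriv_2 (fundamental_form (tb_J1 g) (sasaki g) i) A B C z = 0"
proof (rule ext_deriv_2_exact[OF TS_open z _ _ _ ABC, where \<theta> = "\<lambda>z A. - g i (fst z) (snd z) (fst A)"])
  show "linear (\<lambda>A. - g i (fst z) (snd z) (fst A))" if "z \<in> TS" for z
    using that by (intro linearI) (auto simp: metric_linear)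
  have "smooth_on TS fst" "smooth_on TS snd"
    by (intro smooth_on_bounded_linear TS_open bounded_linear_fst bounded_linear_snd)+
  then have "smooth_on TS (\<lambda>z. g i (fst z) (snd z) (fst a))" for a
    by (intro smooth_on_bilinear_family[where B = "\<lambda>z. g i (fst z)", OF TS_open _
        smooth_on_compose[OF S TS_open smooth] _ smooth_on_const]) (auto intro: bil)
  then show "smooth_on TS (\<lambda>z. - g i (fst z) (snd z) (fst a))" for a
    by (intro smooth_on_minus TS_open)
  fix w A B assume w: "w \<in> TS"
  then have x: "fst w \<in> S" by auto
  have D: "frechet_derivative (\<lambda>z. - g i (fst z) (snd z) (fst B)) (at w) A
     = - (g i (fst w) (snd A + \<Gamma> (fst w) (fst A) (snd w)) (fst B)
          + g i (fst w) (snd w) (0 + \<Gamma> (fst w) (fst A) (fst B)))" for A B :: "'e \<times> 'e"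
  proof -
    have "(snd has_derivative snd) (at w)" by (auto intro!: derivative_eq_intros)
    from has_derivative_minus[OF metric_TS_derivative[OF w this has_derivative_const]]
    have "((\<lambda>z. - g i (fst z) (snd z) (fst B)) has_derivative
     (\<lambda>A. - (g i (fst w) (snd A + \<Gamma> (fst w) (fst A) (snd w)) (fst B)
          + g i (fst w) (snd w) (0 + \<Gamma> (fst w) (fst A) (fst B))))) (at w)" .
    from frechet_derivative_at[OF this, symmetric] show ?thesis by simp
  qed
  show "fundamental_form (tb_J1 g) (sasaki g) i w A B =
      frechet_derivative (\<lambda>z. - g i (fst z) (snd z) (fst B)) (at w) A
      - frechet_derivative (\<lambda>z. - g i (fst z) (snd z) (fst A)) (at w) B"
    unfolding D fundamental_form_def sasaki_eq fst_J1 ver_J1[OF w]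
    using christoffel_works(2)[OF x] sym[OF x]
    by (simp add: ver_def metric_linear[OF x])
qed

section \<open>A connection adapted to the splitting\<close>

text \<open>The Christoffel map of the connection which \<open>\<nabla>\<close> induces on horizontal plus vertical vectors; it is
  characterized by the two parts given below.\<close>

definition "adapted z A B = (\<Gamma> (fst z) (fst A) (fst B),
   dver z A B + \<Gamma> (fst z) (fst A) (ver z B) - \<Gamma> (fst z) (snd z) (\<Gamma> (fst z) (fst A) (fst B)))"

lemma fst_adapted: "fst (adapted z A B) = \<Gamma> (fst z) (fst A) (fst B)"
  and ver_adapted: "ver z (adapted z A B) = dver z A B + \<Gamma> (fst z) (fst A) (ver z B)"
  by (simp_all add: adapted_def ver_def)

lemma adapted_metric:
  assumes z: "z \<in> TS"
  shows "frechet_derivative (\<lambda>z. sasaki g i z B C) (at z) A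
    = sasaki g i z (adapted z A B) C + sasaki g i z B (adapted z A C)"
proof -
  have "((\<lambda>z. sasaki g i z B C) has_derivative (\<lambda>A.
      (g i (fst z) (0 + \<Gamma> (fst z) (fst A) (fst B)) (fst C) + g i (fst z) (fst B) (0 + \<Gamma> (fst z) (fst A) (fst C)))
    + (g i (fst z) (dver z A B + \<Gamma> (fst z) (fst A) (ver z B)) (ver z C)
     + g i (fst z) (ver z B) (dver z A C + \<Gamma> (fst z) (fst A) (ver z C))))) (at z)"
    unfolding sasaki_eq
    by (intro has_derivative_add metric_TS_derivative z has_derivative_const ver_has_derivative)
  from frechet_derivative_at[OF this, symmetric] show ?thesis
    by (simp add: sasaki_eq fst_adapted ver_adapted)
qed

text \<open>\<open>J\<^sub>1\<close> is parallel: it only exchanges the two parts, up to sign, and the connection acts in the same way on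
  both. The two parts of the derivative of \<open>J\<^sub>1\<close> come from differentiating the identities \<open>H(J\<^sub>1B) = -VB\<close> and
  \<open>V(J\<^sub>1B) = HB\<close>.\<close>

lemma adapted_J1:
  assumes z: "z \<in> TS"
  shows "frechet_derivative (\<lambda>z. tb_J1 g i z B) (at z) A + adapted z A (tb_J1 g i z B)
    = tb_J1 g i z (adapted z A B)"
proof -
  have x: "fst z \<in> S" using z by auto
  define D where "D = frechet_derivative (\<lambda>z. tb_J1 g i z B) (at z)"
  have D: "((\<lambda>z. tb_J1 g i z B) has_derivative D) (at z)"
    unfolding D_def by (rule smooth_on_has_derivative[OF J1_smooth z])
  have "((\<lambda>z. - ver z B) has_derivative (\<lambda>A. fst (D A))) (at z)"
    using has_derivative_fst[OF D] unfolding fst_J1 .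
  then have D1: "fst (D A) = - dver z A B"
    by (rule fun_cong[OF has_derivative_unique[OF _ has_derivative_minus[OF ver_has_derivative[OF z]]]])
  have "((\<lambda>z. ver z (tb_J1 g i z B)) has_derivative
      (\<lambda>A. dver z A (tb_J1 g i z B) + ver z (D A))) (at z)"
    unfolding dver_def
    by (rule linear_family_derivative(2)[OF TS_open z ver_linear smooth_on_differentiable[OF ver_smooth z] D])
  then have "((\<lambda>z. fst B) has_derivative (\<lambda>A. dver z A (tb_J1 g i z B) + ver z (D A))) (at z)"
    by (rule has_derivative_transform_within_open[OF _ TS_open z ver_J1])
  from fun_cong[OF has_derivative_unique[OF this has_derivative_const], of A]
  have D2: "ver z (D A) = - dver z A (tb_J1 g i z B)" by (simp add: eq_neg_iff_add_eq_0 add.commute)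
  show ?thesis
    unfolding D_def[symmetric]
    by (rule hor_ver_eqI[of _ _ z])
       (simp_all add: linear_add[OF ver_linear[OF z]] fst_adapted ver_adapted D1 D2 fst_J1 ver_J1[OF z]
          christoffel_linear[OF x])
qed

text \<open>The horizontal part of the torsion vanishes because \<open>\<nabla>\<close> is torsion-free. In the vertical part the terms
  with \<open>snd A\<close> and \<open>snd B\<close> cancel for the same reason, and the others make up \<open>R(HA, HB)y\<close>.\<close>

lemma adapted_torsion:
  assumes z: "z \<in> TS"
  shows "sasaki g i z (adapted z A B - adapted z B A) C
    = g i (fst z) (curv (fst z) (fst A) (fst B) (snd z)) (ver z C)"
proof -
  have x: "fst z \<in> S" using z by auto
  have "fst (adapted z A B - adapted z B A) = 0"
    by (simp add: fst_adapted christoffel_works(2)[OF x])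
  moreover have "ver z (adapted z A B - adapted z B A) = curv (fst z) (fst A) (fst B) (snd z)"
    unfolding linear_diff[OF ver_linear[OF z]] ver_adapted
    unfolding dver_eq[OF z] curv_def ver_def christoffel_linear[OF x]
    using dchristoffel_sym[OF x] christoffel_works(2)[OF x]
    by (simp add: algebra_simps)
  ultimately show ?thesis by (simp add: sasaki_eq metric_linear[OF x])
qed

definition "contorsion z A B C = sasaki g i z (christoffel (sasaki g i) z A B - adapted z A B) C"

text \<open>The algebra behind the Koszul formula. Two metric connections differ by a tensor that is skew in its last two
  arguments. Interchanging its first two arguments and subtracting gives minus the torsion of the adapted
  connection, because the Levi-Civita connection is torsion-free. These two properties determine the tensor.\<close>

lemma contorsion_eq:
  assumes z: "z \<in> TS"
  defines "t \<equiv> (\<lambda>A B C. g i (fst z) (curv (fst z) (fst A) (fst B) (snd z)) (ver z C))"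
  shows "2 * contorsion z A B C = - t A B C + t B C A - t C A B"
proof -
  interpret T: local_metric "sasaki g" i TS by (rule sasaki_local_metric)
  have skew: "contorsion z A B C = - contorsion z A C B" for A B C
    using adapted_metric[OF z, of B C A] T.christoffel_works(3)[OF z, of B C A] T.sym[OF z]
    by (simp add: contorsion_def T.metric_linear[OF z])
  have tor: "contorsion z A B C - contorsion z B A C = - t A B C" for A B C
    unfolding t_def adapted_torsion[OF z, symmetric]
    using T.christoffel_works(2)[OF z, of A B] by (simp add: contorsion_def T.metric_linear[OF z])
  show ?thesis
    using skew[of A B C] skew[of B C A] skew[of C A B] tor[of A B C] tor[of B C A] tor[of C A B] by linarith
qed

text \<open>Subtracting the adapted connection, for which \<open>J\<^sub>1\<close> is parallel, leaves the commutator of the contorsion with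
  \<open>J\<^sub>1\<close>; moving \<open>J\<^sub>1\<close> to the other argument of the metric changes its sign.\<close>

lemma covderiv_J1:
  assumes z: "z \<in> TS" and B: "smooth_on TS B"
  shows "sasaki g i z (covderiv_1_1 (sasaki g i) (tb_J1 g i) A B z) C
    = contorsion z (A z) (tb_J1 g i z (B z)) C + contorsion z (A z) (B z) (tb_J1 g i z C)"
proof -
  interpret T: local_metric "sasaki g" i TS by (rule sasaki_local_metric)
  note J = J1_linear[OF z]
  have "((\<lambda>z. tb_J1 g i z (B z)) has_derivative (\<lambda>v. frechet_derivative (\<lambda>w. tb_J1 g i w (B z)) (at z) v
      + tb_J1 g i z (frechet_derivative B (at z) v))) (at z)"
    by (rule linear_family_derivative(2)[OF TS_open z J1_linear smooth_on_differentiable[OF J1_smooth z]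
          smooth_on_has_derivative[OF B z]])
  from frechet_derivative_at[OF this, symmetric]
  have "covderiv_1_1 (sasaki g i) (tb_J1 g i) A B z = frechet_derivative (\<lambda>w. tb_J1 g i w (B z)) (at z) (A z)
      + christoffel (sasaki g i) z (A z) (tb_J1 g i z (B z)) - tb_J1 g i z (christoffel (sasaki g i) z (A z) (B z))"
    unfolding covderiv_1_1_def covderiv_def dirderiv_def by (simp add: linear_add[OF J])
  also have "\<dots> = (christoffel (sasaki g i) z (A z) (tb_J1 g i z (B z)) - adapted z (A z) (tb_J1 g i z (B z)))
      - tb_J1 g i z (christoffel (sasaki g i) z (A z) (B z) - adapted z (A z) (B z))"
    unfolding linear_diff[OF J] adapted_J1[OF z, symmetric] by simp
  finally show ?thesis
    by (simp add: contorsion_def T.metric_linear[OF z] sasaki_J1[OF z])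
qed

lemma curv_zero:
  assumes x: "x \<in> S" shows "curv x 0 u v = 0" "curv x u 0 v = 0" "curv x u (- w) v = - curv x u w v"
  using bilinear_lzero[OF dchristoffel_bilinear[OF x]] linear_0[OF dchristoffel_linear[OF x]]
    bilinear_lneg[OF dchristoffel_bilinear[OF x]] linear_neg[OF dchristoffel_linear[OF x]]
  by (simp_all add: curv_def christoffel_linear[OF x])

lemma kaehler_iff:
  "(\<forall>A B C. smooth_on TS A \<and> smooth_on TS B \<and> smooth_on TS C \<longrightarrow>
     (\<forall>z\<in>TS. sasaki g i z (covderiv_1_1 (sasaki g i) (tb_J1 g i) A B z) (C z) = 0))
   \<longleftrightarrow> (\<forall>x\<in>S. \<forall>u v w. curv x u v w = 0)" (is "?K \<longleftrightarrow> ?R")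
proof
  assume K: ?K
  show ?R
  proof (intro ballI allI, rule metric_cancel)
    fix x u v y :: 'e
    assume x: "x \<in> S"
    show "x \<in> S" by fact
    fix w
    let ?z = "(x, y)"
    have z: "?z \<in> TS" using x by simp
    \<comment> \<open>With these parts only torsion terms whose first two arguments are \<open>B\<close> and \<open>J\<^sub>1C\<close> survive.\<close>
    obtain A where A: "fst A = 0" "ver ?z A = w" using hor_ver_exists by blast
    obtain B where B: "fst B = u" "ver ?z B = 0" using hor_ver_exists by blast
    obtain C where C: "fst C = 0" "ver ?z C = v" using hor_ver_exists by blast
    have "sasaki g i ?z (covderiv_1_1 (sasaki g i) (tb_J1 g i) (\<lambda>_. A) (\<lambda>_. B) ?z) C = 0"
      using K z by (metis (mono_tags, lifting) smooth_on_const)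
    then have "2 * contorsion ?z A (tb_J1 g i ?z B) C + 2 * contorsion ?z A B (tb_J1 g i ?z C) = 0"
      unfolding covderiv_J1[OF z smooth_on_const] by simp
    then show "g i x (curv x u v y) w = g i x 0 w"
      unfolding contorsion_eq[OF z]
      by (simp add: A B C fst_J1 ver_J1[OF z] curv_zero[OF x] metric_linear[OF x])
  qed
next
  assume ?R
  then have "contorsion z A B C = 0" if "z \<in> TS" for z A B C
    using contorsion_eq[OF that, of A B C] that by (auto simp: metric_linear)
  then show ?K by (simp add: covderiv_J1)
qed

end

section \<open>Signature\<close>

lemma has_signatureE:
  fixes b :: "'e::euclidean_space \<Rightarrow> 'e \<Rightarrow> real"
  assumes "has_signature b p q"
  obtains P N where "subspace P" "subspace N" "dim P = p" "dim N = q" "\<forall>u\<in>P. \<forall>v\<in>N. b u v = 0"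
    "\<forall>u\<in>P - {0}. b u u > 0" "\<forall>v\<in>N - {0}. b v v < 0" "p + q = DIM('e)"
  using assms unfolding has_signature_def by (elim exE conjE)

lemma has_signature_nondegenerate:
  fixes b :: "'e::euclidean_space \<Rightarrow> 'e \<Rightarrow> real"
  assumes b: "bilinear b" and sym: "\<And>u v. b u v = b v u" and sig: "has_signature b p q"
    and w: "\<And>z. b w z = 0"
  shows "w = 0"
proof -
  obtain P N where PN: "subspace P" "subspace N" "dim P = p" "dim N = q" "\<forall>u\<in>P. \<forall>v\<in>N. b u v = 0"
    "\<forall>u\<in>P - {0}. b u u > 0" "\<forall>v\<in>N - {0}. b v v < 0" and pq: "p + q = DIM('e)"
    using sig by (rule has_signatureE)
  have "u = 0" if "u \<in> P" "u \<in> N" for u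
  proof (rule ccontr)
    assume "u \<noteq> 0"
    then have "b u u > 0" "b u u < 0" using PN(6,7) that by blast+
    then show False by simp
  qed
  then have "P \<inter> N = {0}" using subspace_0[OF PN(1)] subspace_0[OF PN(2)] by blast
  then have "dim {x + y |x y. x \<in> P \<and> y \<in> N} = DIM('e)"
    using dim_sums_Int[OF PN(1,2)] PN(3,4) pq by simp
  then have "{x + y |x y. x \<in> P \<and> y \<in> N} = UNIV"
    using subspace_sums[OF PN(1,2)] by (simp add: dim_eq_full span_eq_iff[THEN iffD2])
  then obtain u v where uv: "u \<in> P" "v \<in> N" "w = u + v" by blast
  have "b u u = 0"
    using w[of u] uv PN(5) sym[of v u] by (simp add: bilinear_ladd[OF b])
  then have u: "u = 0" using PN(6) uv by force
  have "b v v = 0" using w[of v] uv u by simp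
  then show ?thesis using PN(7) uv u by force
qed

text \<open>A maximal positive subspace of the Sasaki metric consists of the vectors with both parts in a maximal
  positive subspace of \<open>g\<close>, and similarly for negative subspaces; hence the signature doubles.\<close>

lemma (in local_metric) sasaki_signature:
  assumes z: "z \<in> TS" and sig: "has_signature (g i (fst z)) p q"
  shows "has_signature (sasaki g i z) (p + p) (q + q)"
proof -
  have x: "fst z \<in> S" using z by auto
  obtain P N where PN: "subspace P" "subspace N" "dim P = p" "dim N = q" "\<forall>u\<in>P. \<forall>v\<in>N. g i (fst z) u v = 0"
    "\<forall>u\<in>P - {0}. g i (fst z) u u > 0" "\<forall>v\<in>N - {0}. g i (fst z) v v < 0" and pq: "p + q = DIM('e)"
    using sig by (rule has_signatureE)
  define F where "F A = (fst A, ver z A)" for A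
  have F: "linear F"
    unfolding F_def by (rule linearI) (simp_all add: linear_add[OF ver_linear[OF z]] linear_scale[OF ver_linear[OF z]])
  have injF: "inj F" unfolding F_def by (rule injI, rule hor_ver_eqI[of _ _ z]) simp_all
  have sub: "subspace (F -` (W \<times> W))" and dm: "dim (F -` (W \<times> W)) = dim W + dim W"
    if W: "subspace W" for W
  proof -
    show "subspace (F -` (W \<times> W))" using linear_subspace_vimage[OF F subspace_Times[OF W W]] .
    have "u \<in> range F" for u
    proof -
      obtain A where "fst A = fst u" "ver z A = snd u" using hor_ver_exists by blast
      then have "u = F A" by (simp add: F_def)
      then show ?thesis by blast
    qed
    then have "F ` (F -` (W \<times> W)) = W \<times> W" by auto
    then show "dim (F -` (W \<times> W)) = dim W + dim W"
      using dim_image_eq[OF F inj_on_subset[OF injF subset_UNIV], of "F -` (W \<times> W)"] dim_Times[OF W W] by simp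
  qed
  have nz: "fst A \<noteq> 0 \<or> ver z A \<noteq> 0" if "A \<noteq> 0" for A
    using that hor_ver_eqI[of A 0 z] linear_0[OF ver_linear[OF z]] by auto
  have pos: "u \<noteq> 0 \<Longrightarrow> g i (fst z) u u > 0" if "u \<in> P" for u using PN(6) that by blast
  then have pos0: "g i (fst z) u u \<ge> 0" if "u \<in> P" for u
    using that by (cases "u = 0") (auto simp: metric_linear[OF x] less_imp_le)
  have neg: "u \<noteq> 0 \<Longrightarrow> g i (fst z) u u < 0" if "u \<in> N" for u using PN(7) that by blast
  then have neg0: "g i (fst z) u u \<le> 0" if "u \<in> N" for u
    using that by (cases "u = 0") (auto simp: metric_linear[OF x] less_imp_le)
  have dims: "p + p + (q + q) = DIM('e \<times> 'e)" using pq by simp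
  show ?thesis
    unfolding has_signature_def
  proof (rule conjI[OF dims exI[of _ "F -` (P \<times> P)", OF exI[of _ "F -` (N \<times> N)"]]], intro conjI ballI)
    show "sasaki g i z A B = 0" if "A \<in> F -` (P \<times> P)" "B \<in> F -` (N \<times> N)" for A B
      using that PN(5) by (simp add: F_def sasaki_eq)
    show "sasaki g i z A A > 0" if "A \<in> F -` (P \<times> P) - {0}" for A
      using that nz[of A] pos0[of "fst A"] pos0[of "ver z A"] pos[of "fst A"] pos[of "ver z A"]
      by (auto simp: F_def sasaki_eq intro: add_pos_nonneg add_nonneg_pos)
    show "sasaki g i z A A < 0" if "A \<in> F -` (N \<times> N) - {0}" for A
      using that nz[of A] neg0[of "fst A"] neg0[of "ver z A"] neg[of "fst A"] neg[of "ver z A"]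
      by (auto simp: F_def sasaki_eq intro: add_neg_nonpos add_nonpos_neg)
  qed (use sub dm PN in auto)
qed

section \<open>Transformation laws\<close>

locale pseudo_riemannian_manifold = manifold M
  for M :: "('a, 'i, 'e::euclidean_space) atlas" +
  fixes g :: "'i \<Rightarrow> 'e \<Rightarrow> 'e \<Rightarrow> 'e \<Rightarrow> real" and p q :: nat
  assumes pseudo_riemannian: "pseudo_riemannian M g p q"
begin

lemma local_metric_chart: "i \<in> idx M \<Longrightarrow> local_metric g i (cimg M i)"
proof -
  assume i: "i \<in> idx M"
  note g = pseudo_riemannian[unfolded pseudo_riemannian_def tensor_0_2_def]
  show ?thesis
  proof
    show "open (cimg M i)" by (rule cimg_open[OF i])
    show bil: "bilinear (g i x)" if "x \<in> cimg M i" for x using g i that by blast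
    show sym: "g i x u v = g i x v u" if "x \<in> cimg M i" for x u v using g i that by blast
    show "smooth_on (cimg M i) (\<lambda>x. g i x u v)" for u v using g i by blast
    show "w = 0" if "x \<in> cimg M i" "\<And>z. g i x w z = 0" for x w
      by (rule has_signature_nondegenerate[OF bil sym _ that(2)]) (use g i that(1) in auto)
  qed
qed

lemma metric_transform:
  "i \<in> idx M \<Longrightarrow> j \<in> idx M \<Longrightarrow> x \<in> overlap M i j \<Longrightarrow>
    g j (transition M i j x) (jacobian M i j x u) (jacobian M i j x v) = g i x u v"
  using pseudo_riemannian unfolding pseudo_riemannian_def tensor_0_2_def by blast

text \<open>As a function of the two transported vectors, the right-hand side is a symmetric bilinear map at the image
  point, by the symmetry of the Hessian. Differentiating the transformation law of \<open>g\<close> shows that it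
  is compatible with the metric in the chart \<open>j\<close>, so it is the Levi-Civita connection there by uniqueness.\<close>

lemma christoffel_transform:
  assumes ij: "i \<in> idx M" "j \<in> idx M" and x: "x \<in> overlap M i j"
  shows "christoffel (g j) (transition M i j x) (jacobian M i j x u) (jacobian M i j x v)
    = jacobian M i j x (christoffel (g i) x u v) - frechet_derivative (\<lambda>z. jacobian M i j z v) (at x) u"
proof -
  interpret I: local_metric g i "cimg M i" by (rule local_metric_chart[OF ij(1)])
  interpret J: local_metric g j "cimg M j" by (rule local_metric_chart[OF ij(2)])
  define \<phi> where "\<phi> = transition M i j"
  define D where "D = jacobian M i j"
  define E where "E = jacobian M j i (\<phi> x)"
  define H where "H u v = frechet_derivative (\<lambda>z. D z v) (at x) u" for u v
  note O = overlap_open[OF ij]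
  have xi: "x \<in> cimg M i" using x overlap_subset by blast
  have yj: "\<phi> z \<in> cimg M j" if "z \<in> overlap M i j" for z
    unfolding \<phi>_def using transition_in_overlap[OF ij(1) that] overlap_subset by blast
  have ED: "E (D x u) = u" and DE: "D x (E u) = u" for u
    unfolding D_def E_def \<phi>_def by (rule jacobian_inverse[OF ij x])+
  have linD: "linear (D z)" if "z \<in> overlap M i j" for z unfolding D_def by (rule jacobian_linear[OF ij that])
  have linE: "linear E"
    unfolding E_def \<phi>_def by (rule jacobian_linear[OF ij(2,1) transition_in_overlap[OF ij(1) x]])
  have smD: "smooth_on (overlap M i j) (\<lambda>z. D z u)" for u unfolding D_def by (rule jacobian_smooth[OF ij])
  have derD: "((\<lambda>z. D z u) has_derivative (\<lambda>v. H v u)) (at x)" for u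
    unfolding H_def by (rule smooth_on_has_derivative[OF smD x])
  have derphi: "(\<phi> has_derivative D x) (at x)"
    unfolding \<phi>_def D_def by (rule transition_has_derivative[OF ij x])
  have H_sym: "H u v = H v u" for u v
    unfolding H_def D_def jacobian_def by (rule symmetric_second_derivative[OF O x transition_smooth[OF ij]])
  have H_lin: "linear (\<lambda>v. H u v)" for u
    unfolding H_def
    by (rule linear_family_derivative(1)[OF O x linD smooth_on_differentiable[OF smD x] has_derivative_const])
  define G where "G a b = D x (I.\<Gamma> x (E a) (E b)) - H (E a) (E b)" for a b
  have G_sym: "G a b = G b a" for a b
    unfolding G_def using I.christoffel_works(2)[OF xi] H_sym by metis
  have "linear (G a)" for a
    unfolding G_def
    by (rule linearI)
       (simp_all add: linear_add[OF linE] linear_scale[OF linE] linear_add[OF linD[OF x]] linear_scale[OF linD[OF x]]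
          I.christoffel_linear[OF xi] linear_add[OF H_lin] linear_scale[OF H_lin] scaleR_diff_right)
  then have G_bil: "bilinear G"
    unfolding bilinear_def using G_sym by simp
  have "J.\<Gamma> (\<phi> x) = G"
  proof (rule J.christoffel_unique[OF yj[OF x] G_bil G_sym])
    fix a b c
    define u v w where "u = E a" and "v = E b" and "w = E c"
    have abc: "a = D x u" "b = D x v" "c = D x w" by (simp_all add: u_def v_def w_def DE)
    have dj: "((\<lambda>z. g j (\<phi> z) a b) has_derivative
       (\<lambda>w. frechet_derivative (\<lambda>y. g j y a b) (at (\<phi> x)) (D x w))) (at x)" for a b
      by (rule has_derivative_compose[OF derphi smooth_on_has_derivative[OF J.smooth yj[OF x]]])
    then have dj': "(\<lambda>z. g j (\<phi> z) a b) differentiable (at x)" for a b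
      unfolding differentiable_def by blast
    \<comment> \<open>This function of \<open>z\<close> is \<open>g i z u v\<close>, whose derivative the Christoffel map of the chart \<open>i\<close> describes.\<close>
    have "((\<lambda>z. g j (\<phi> z) (D z u) (D z v)) has_derivative (\<lambda>w.
       frechet_derivative (\<lambda>z. g j (\<phi> z) (D x u) (D x v)) (at x) w
       + g j (\<phi> x) (H w u) (D x v) + g j (\<phi> x) (D x u) (H w v))) (at x)"
      by (rule bilinear_family_derivative(2)[OF O x J.bil[OF yj] dj' derD derD])
    then have "((\<lambda>z. g i z u v) has_derivative (\<lambda>w.
       frechet_derivative (\<lambda>z. g j (\<phi> z) (D x u) (D x v)) (at x) w
       + g j (\<phi> x) (H w u) (D x v) + g j (\<phi> x) (D x u) (H w v))) (at x)"
      by (rule has_derivative_transform_within_open[OF _ O x])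
         (simp add: \<phi>_def D_def metric_transform[OF ij])
    from fun_cong[OF frechet_derivative_at[OF this], of w]
    have "g i x (I.\<Gamma> x w u) v + g i x u (I.\<Gamma> x w v) = frechet_derivative (\<lambda>y. g j y a b) (at (\<phi> x)) c
       + g j (\<phi> x) (H w u) b + g j (\<phi> x) a (H w v)"
      unfolding I.christoffel_works(3)[OF xi] abc
      by (simp add: frechet_derivative_at[OF dj, symmetric])
    moreover have "g i x (I.\<Gamma> x w u) v = g j (\<phi> x) (D x (I.\<Gamma> x w u)) b"
      "g i x u (I.\<Gamma> x w v) = g j (\<phi> x) a (D x (I.\<Gamma> x w v))"
      unfolding abc D_def \<phi>_def metric_transform[OF ij x] by (rule refl)+
    ultimately show "frechet_derivative (\<lambda>y. g j y a b) (at (\<phi> x)) c = g j (\<phi> x) (G c a) b + g j (\<phi> x) a (G c b)"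
      by (simp add: G_def u_def v_def w_def J.metric_linear[OF yj[OF x]])
  qed
  then have "J.\<Gamma> (\<phi> x) (D x u) (D x v) = D x (I.\<Gamma> x u v) - H u v"
    by (simp add: G_def ED)
  then show ?thesis by (simp add: \<phi>_def D_def H_def)
qed

text \<open>Horizontal and vertical parts transform by the Jacobian of \<open>M\<close>: the Hessian in the Jacobian of the bundle
  transition is compensated by the one in the transformation law of the Christoffel map, after exchanging the
  arguments of the Hessian.\<close>

lemma ver_transform:
  assumes ij: "i \<in> idx M" "j \<in> idx M" and z: "z \<in> overlap M i j \<times> UNIV"
  shows "fst (jacobian TM i j z A) = jacobian M i j (fst z) (fst A)"
    and "local_metric.ver g j (transition TM i j z) (jacobian TM i j z A) =
      jacobian M i j (fst z) (local_metric.ver g i z A)"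
proof -
  interpret I: local_metric g i "cimg M i" by (rule local_metric_chart[OF ij(1)])
  interpret J: local_metric g j "cimg M j" by (rule local_metric_chart[OF ij(2)])
  have x: "fst z \<in> overlap M i j" using z by auto
  have xi: "fst z \<in> cimg M i" using x overlap_subset by blast
  note jac = jacobian_TM[OF ij x, of "snd z", simplified]
  show "fst (jacobian TM i j z A) = jacobian M i j (fst z) (fst A)" by (simp add: jac)
  have hess: "frechet_derivative (\<lambda>w. jacobian M i j w (snd z)) (at (fst z)) (fst A) =
      frechet_derivative (\<lambda>w. jacobian M i j w (fst A)) (at (fst z)) (snd z)"
    unfolding jacobian_def
    by (rule symmetric_second_derivative[OF overlap_open[OF ij] x transition_smooth[OF ij]])
  show "J.ver (transition TM i j z) (jacobian TM i j z A) = jacobian M i j (fst z) (I.ver z A)"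
    unfolding J.ver_def I.ver_def transition_TM[OF ij z] jac
    by (simp add: christoffel_transform[OF ij x] linear_add[OF jacobian_linear[OF ij x]] hess)
qed

lemma sasaki_tensor: "pseudo_riemannian TM (sasaki g) (p + p) (q + q)"
proof -
  have loc: "local_metric (sasaki g) i (cimg M i \<times> UNIV)" if "i \<in> idx M" for i
    by (rule local_metric.sasaki_local_metric[OF local_metric_chart[OF that]])
  have trans: "sasaki g j (transition TM i j z) (jacobian TM i j z A) (jacobian TM i j z B) = sasaki g i z A B"
    if ij: "i \<in> idx M" "j \<in> idx M" and z: "z \<in> overlap M i j \<times> UNIV" for i j z A B
  proof -
    have x: "fst z \<in> overlap M i j" using z by auto
    have fst: "fst (transition TM i j z) = transition M i j (fst z)" by (simp add: transition_TM[OF ij z])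
    show ?thesis
      unfolding local_metric.sasaki_eq[OF local_metric_chart[OF ij(1)]]
        local_metric.sasaki_eq[OF local_metric_chart[OF ij(2)]] ver_transform[OF ij z] fst metric_transform[OF ij x] ..
  qed
  have sig: "has_signature (sasaki g i z) (p + p) (q + q)" if i: "i \<in> idx M" and z: "z \<in> cimg M i \<times> UNIV" for i z
    by (rule local_metric.sasaki_signature[OF local_metric_chart[OF i] z])
       (use pseudo_riemannian i z in \<open>auto simp: pseudo_riemannian_def\<close>)
  show ?thesis
    unfolding pseudo_riemannian_def tensor_0_2_def TM_simps
  proof (intro conjI ballI allI)
    fix i assume i: "i \<in> idx M"
    interpret local_metric "sasaki g" i "cimg M i \<times> UNIV" by (rule loc[OF i])
    show "smooth_on (cimg TM i) (\<lambda>z. sasaki g i z A B)" for A B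
      unfolding cimg_TM[OF i] by (rule smooth)
    show "sasaki g j (transition TM i j z) (jacobian TM i j z A) (jacobian TM i j z B) = sasaki g i z A B"
      if "j \<in> idx M" "z \<in> overlap TM i j" for j z A B
      using trans[OF i that(1)] that(2) unfolding overlap_TM[OF i] .
    fix z assume "z \<in> cimg TM i"
    then have z: "z \<in> cimg M i \<times> UNIV" unfolding cimg_TM[OF i] .
    show "bilinear (sasaki g i z)" by (rule bil[OF z])
    show "sasaki g i z A B = sasaki g i z B A" for A B by (rule sym[OF z])
    show "has_signature (sasaki g i z) (p + p) (q + q)" by (rule sig[OF i z])
  qed
qed

lemma J1_almost_complex: "almost_complex TM (tb_J1 g)"
proof -
  have trans: "tb_J1 g j (transition TM i j z) (jacobian TM i j z A) = jacobian TM i j z (tb_J1 g i z A)"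
    if ij: "i \<in> idx M" "j \<in> idx M" and z: "z \<in> overlap M i j \<times> UNIV" for i j z A
  proof -
    interpret I: local_metric g i "cimg M i" by (rule local_metric_chart[OF ij(1)])
    interpret J: local_metric g j "cimg M j" by (rule local_metric_chart[OF ij(2)])
    have x: "fst z \<in> overlap M i j" using z by auto
    have zi: "z \<in> cimg M i \<times> UNIV" using z overlap_subset by fastforce
    have zj: "transition TM i j z \<in> cimg M j \<times> UNIV"
      using transition_in_overlap[OF ij(1) x] overlap_subset by (auto simp: transition_TM[OF ij z])
    show ?thesis
      by (rule J.hor_ver_eqI[of _ _ "transition TM i j z"])
         (simp_all add: I.fst_J1 J.fst_J1 I.ver_J1[OF zi] J.ver_J1[OF zj] ver_transform[OF ij z]
            linear_neg[OF jacobian_linear[OF ij x]])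
  qed
  show ?thesis
    unfolding almost_complex_def tensor_1_1_def TM_simps
  proof (intro conjI ballI allI)
    fix i assume i: "i \<in> idx M"
    interpret local_metric g i "cimg M i" by (rule local_metric_chart[OF i])
    show "smooth_on (cimg TM i) (\<lambda>z. tb_J1 g i z A)" for A
      unfolding cimg_TM[OF i] by (rule J1_smooth)
    show "tb_J1 g j (transition TM i j z) (jacobian TM i j z A) = jacobian TM i j z (tb_J1 g i z A)"
      if "j \<in> idx M" "z \<in> overlap TM i j" for j z A
      using trans[OF i that(1)] that(2) unfolding overlap_TM[OF i] .
    fix z assume "z \<in> cimg TM i"
    then have z: "z \<in> cimg M i \<times> UNIV" unfolding cimg_TM[OF i] .
    show "linear (tb_J1 g i z)" by (rule J1_linear[OF z])
    show "tb_J1 g i z (tb_J1 g i z A) = - A" for A by (rule J1_J1[OF z])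
  qed
qed

lemma almost_hermitian_TM: "almost_hermitian TM (tb_J1 g) (sasaki g)"
  unfolding almost_hermitian_def TM_simps
  using smooth_manifold_TM J1_almost_complex sasaki_tensor
    local_metric.sasaki_J1_J1[OF local_metric_chart] cimg_TM by blast

section \<open>Almost Kaehler and Kaehler structure of the tangent bundle\<close>

theorem almost_kaehler_TM: "almost_kaehler TM (tb_J1 g) (sasaki g)"
  unfolding almost_kaehler_def TM_simps
  using almost_hermitian_TM cimg_TM local_metric.fundamental_form_closed[OF local_metric_chart]
  by simp

theorem kaehler_TM_iff_flat: "kaehler TM (tb_J1 g) (sasaki g) \<longleftrightarrow> flat M g"
proof -
  have "kaehler TM (tb_J1 g) (sasaki g) \<longleftrightarrow>
    (\<forall>i\<in>idx M. \<forall>x\<in>cimg M i. \<forall>u v w. local_metric.curv g i x u v w = 0)"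
    unfolding kaehler_def TM_simps
    using almost_hermitian_TM cimg_TM local_metric.kaehler_iff[OF local_metric_chart] by simp
  also have "\<dots> \<longleftrightarrow> flat M g"
    unfolding flat_def using local_metric.flat_iff[OF local_metric_chart] by simp
  finally show ?thesis .
qed

end

theorem theorem3p12:
  fixes M :: "('a, 'i, 'e::euclidean_space) atlas"
    and J :: "'i \<Rightarrow> 'e \<Rightarrow> 'e \<Rightarrow> 'e"
    and g gt :: "'i \<Rightarrow> 'e \<Rightarrow> 'e \<Rightarrow> 'e \<Rightarrow> real"
    and n :: nat
  assumes "almost_skew_hermitian n M J g gt"
  shows "almost_kaehler (tangent_bundle M) (tb_J1 g) (sasaki g) \<and>
    (kaehler (tangent_bundle M) (tb_J1 g) (sasaki g) \<longleftrightarrow> flat M g)"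
proof -
  interpret pseudo_riemannian_manifold M g n n
    using assms by unfold_locales (simp_all add: almost_skew_hermitian_def)
  show ?thesis using almost_kaehler_TM kaehler_TM_iff_flat by blast
qed

end
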